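(* Let $g_1,\dots,g_m\in\mathbb{R}[x]=\mathbb{R}[x_1,\dots,x_n]$ be sos-concave polynomials, let $S=\{x\in\mathbb{R}^n: g_1(x)\ge 0,\dots,g_m(x)\ge 0\}$, and assume $S$ has nonempty interior. Let $I_1,\dots,I_K$ be a fixed partition of $\{1,\dots,n\}$ for which the decomposition assumption stated in the context holds, and let $F_1,\dots,F_K$, $g(x,y)$ and $M_{F_1}(x,y),\dots,M_{F_K}(x,y)$ be as defined in the context. Then $S=L$, where $$L=\Big\{x\in\mathbb{R}^n:\ \exists\, y=(y_\alpha)_{\alpha\in\mathbb{N}^n,\,1<|\alpha|\le 2d}\ \text{ real, such that } g(x,y)\ge 0 \text{ and } M_{F_i}(x,y)\succeq 0 \text{ for } i=1,\dots,K\Big\}.$$ That is, $L$ is an SDP (semidefinite) representation of the convex set $S$.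
   Context: A polynomial $f\in\mathbb{R}[x]$ is sos-convex if its Hessian factors as $\nabla^2 f(x)=W(x)^TW(x)$ for some (not necessarily square) matrix $W(x)$ with real polynomial entries; $g$ is sos-concave if $-g$ is sos-convex. $X\succeq 0$ means the symmetric matrix $X$ is positive semidefinite; $v\ge 0$ for a vector is entrywise. A set has an SDP representation if it is the set of $x\in\mathbb{R}^n$ for which there is $w\in\mathbb{R}^M$ with $A+\sum_i x_iB_i+\sum_j w_jC_j\succeq 0$, for some fixed symmetric matrices $A,B_i,C_j$. Supporting triple: $(a,b,\lambda)$ with $0\ne a\in\mathbb{R}^n$, $b\in\mathbb{R}$, $\lambda=(\lambda_1,\dots,\lambda_m)$ with all $\lambda_k\ge 0$, such that $S\subseteq\{x\in\mathbb{R}^n: a^Tx\ge b\}$ and there is a point $u\in\partial S$ (the boundary of $S$) with $a^Tu=b$, $a=\sum_{k=1}^m\lambda_k\nabla g_k(u)$, and $\lambda_k g_k(u)=0$ for $k=1,\dots,m$ (that is, $\lambda$ is a vector of Lagrange multipliers at $u$). Partition: $I_1,\dots,I_K$ are pairwise disjoint with union $\{1,\dots,n\}$; $x_{I_i}$ denotes the subvector of $x$ with indices in $I_i$. Decomposition assumption: for every supporting triple $(a,b,\lambda)$ there are polynomials $\phi_\lambda^{(i)}$, each in the variables $x_{I_i}$ only, with $$a^Tx-b-\sum_{k=1}^m\lambda_k g_k(x)=\phi_\lambda^{(1)}(x_{I_1})+\cdots+\phi_\lambda^{(K)}(x_{I_K}).$$ For a polynomial $p$, $\mathrm{supp}(p)\subset\mathbb{N}^n$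 is the set of exponents of the monomials occurring in $p$ with nonzero coefficient. $F_i$ is the set of all integer points (exponent vectors in $\mathbb{N}^n$, necessarily supported on the indices $I_i$) lying in the convex hull of $\tfrac12\big(\{0\}\cup\bigcup \mathrm{supp}(\phi_\lambda^{(i)})\big)$, the union being over all supporting triples $(a,b,\lambda)$. $\mathbf{m}_{F_i}(x_{I_i})$ denotes the column vector of the monomials whose exponents lie in $F_i$. $d\ge 1$ is the smallest positive integer such that $\deg g_k\le 2d$ for all $k$. For $\alpha\in\mathbb{N}^n$, $|\alpha|=\alpha_1+\cdots+\alpha_n$ and $x^\alpha=x_1^{\alpha_1}\cdots x_n^{\alpha_n}$. Linearization $g(x,y)$: let $\tilde g_0,\tilde g_j,\tilde g_\alpha\in\mathbb{R}^m$ be the coefficient vectors with $(g_1(x),\dots,g_m(x))^T=\tilde g_0+\sum_{j=1}^n x_j\tilde g_j+\sum_{1<|\alpha|\le 2d}x^\alpha\tilde g_\alpha$; then $g(x,y)=\tilde g_0+\sum_{j=1}^n x_j\tilde g_j+\sum_{1<|\alpha|\le 2d}y_\alpha\tilde g_\alpha$. Sparse moment matrices: let $M_0^{(i)},M_j^{(i)},M_\alpha^{(i)}$ be the symmetric coefficient matrices with $\mathbf{m}_{F_i}(x_{I_i})\mathbf{m}_{F_i}(x_{I_i})^T=M_0^{(i)}+\sum_{j\in I_i}x_jM_j^{(i)}+\sum_{1<|\alpha|\le 2d}x^\alpha M_\alpha^{(i)}$; then $M_{F_i}(x,y)=M_0^{(i)}+\sum_{j\in I_i}x_jM_j^{(i)}+\sum_{1<|\alpha|\le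 2d}y_\alpha M_\alpha^{(i)}$. *)

theory Defs
  imports "HOL-Analysis.Analysis" "HOL-Library.Poly_Mapping"
begin

text \<open>
  The exponent of a monomial is a vector of type \<^typ>\<open>nat^'n\<close>. A polynomial is a finitely
  supported family of coefficients; \<open>Poly_Mapping\<close> supplies the ring structure (the product is
  the convolution), \<open>lookup p \<alpha>\<close> is the coefficient at \<open>x\<^sup>\<alpha>\<close> and \<open>keys p\<close> is \<open>supp(p)\<close>.
\<close>

type_synonym 'n mpoly = "(nat^'n) \<Rightarrow>\<^sub>0 real"

abbreviation Const :: "real \<Rightarrow> 'n::finite mpoly" where
  "Const c \<equiv> Poly_Mapping.single 0 c"

abbreviation Mon :: "nat^'n \<Rightarrow> 'n::finite mpoly" where
  "Mon \<alpha> \<equiv> Poly_Mapping.single \<alpha> 1"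

abbreviation Var :: "'n \<Rightarrow> 'n::finite mpoly" where
  "Var j \<equiv> Mon (axis j 1)"

definition mdeg :: "nat^'n::finite \<Rightarrow> nat" where
  "mdeg \<alpha> = (\<Sum>i\<in>UNIV. \<alpha> $ i)"

definition total_degree :: "'n::finite mpoly \<Rightarrow> nat" where
  "total_degree p = Max (insert 0 (mdeg ` Poly_Mapping.keys p))"

definition eval_mon :: "real^'n \<Rightarrow> nat^'n::finite \<Rightarrow> real" where
  "eval_mon x \<alpha> = (\<Prod>i\<in>UNIV. x $ i ^ (\<alpha> $ i))"

definition eval_mpoly :: "'n::finite mpoly \<Rightarrow> real^'n \<Rightarrow> real" where
  "eval_mpoly p x = (\<Sum>\<alpha>\<in>Poly_Mapping.keys p. Poly_Mapping.lookup p \<alpha> * eval_mon x \<alpha>)"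

text \<open>The truncated subtraction is harmless: its coefficient is zero when \<open>\<alpha> $ i = 0\<close>.\<close>

definition partial_deriv :: "'n \<Rightarrow> 'n::finite mpoly \<Rightarrow> 'n mpoly" where
  "partial_deriv i p =
     (\<Sum>\<alpha>\<in>Poly_Mapping.keys p. Poly_Mapping.single (\<alpha> - axis i 1) 
        (real (\<alpha> $ i) * Poly_Mapping.lookup p \<alpha>))"

definition gradient :: "'n::finite mpoly \<Rightarrow> real^'n \<Rightarrow> real^'n" where
  "gradient p u = (\<chi> i. eval_mpoly (partial_deriv i p) u)"

definition only_variables :: "'n set \<Rightarrow> 'n::finite mpoly \<Rightarrow> bool" where
  "only_variables J p \<longleftrightarrow> (\<forall>\<alpha>\<in>Poly_Mapping.keys p. \<forall>j. \<alpha> $ j \<noteq> 0 \<longrightarrow> j \<in> J)"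

text \<open>\<open>W\<close> is an \<open>r \<times> n\<close> matrix of polynomials; the Hessian identity is one of polynomials.\<close>

definition sos_convex :: "'n::finite mpoly \<Rightarrow> bool" where
  "sos_convex f \<longleftrightarrow> (\<exists>(r::nat) (W :: nat \<Rightarrow> 'n \<Rightarrow> 'n mpoly).
     \<forall>i j. partial_deriv i (partial_deriv j f) = (\<Sum>l<r. W l i * W l j))"

definition sos_concave :: "'n::finite mpoly \<Rightarrow> bool" where
  "sos_concave f \<longleftrightarrow> sos_convex (- f)"

text \<open>
  Matrices whose rows and columns are indexed by a finite set \<open>A\<close> are functions of two
  arguments, of which only the values on \<open>A\<close> matter.
\<close>

definition symmetric_on :: "'i set \<Rightarrow> ('i \<Rightarrow> 'i \<Rightarrow> real) \<Rightarrow> bool" where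
  "symmetric_on A X \<longleftrightarrow> (\<forall>p\<in>A. \<forall>q\<in>A. X p q = X q p)"

definition psd_on :: "'i set \<Rightarrow> ('i \<Rightarrow> 'i \<Rightarrow> real) \<Rightarrow> bool" where
  "psd_on A X \<longleftrightarrow> finite A \<and> symmetric_on A X \<and>
     (\<forall>v :: 'i \<Rightarrow> real. 0 \<le> (\<Sum>p\<in>A. \<Sum>q\<in>A. v p * X p q * v q))"

definition sdp_representable :: "(real^'n::finite) set \<Rightarrow> bool" where
  "sdp_representable T \<longleftrightarrow>
     (\<exists>(N::nat) (M::nat) (A :: nat \<Rightarrow> nat \<Rightarrow> real) (B :: 'n \<Rightarrow> nat \<Rightarrow> nat \<Rightarrow> real)
        (C :: nat \<Rightarrow> nat \<Rightarrow> nat \<Rightarrow> real).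
        symmetric_on {..<N} A \<and> (\<forall>i. symmetric_on {..<N} (B i)) \<and>
        (\<forall>j<M. symmetric_on {..<N} (C j)) \<and>
        T = {x. \<exists>w :: nat \<Rightarrow> real. psd_on {..<N}
               (\<lambda>p q. A p q + (\<Sum>i\<in>UNIV. x $ i * B i p q) + (\<Sum>j<M. w j * C j p q))})"

definition feasible_set :: "('m::finite \<Rightarrow> 'n::finite mpoly) \<Rightarrow> (real^'n) set" where
  "feasible_set g = {x. \<forall>k. 0 \<le> eval_mpoly (g k) x}"

definition supporting_triples ::
  "('m::finite \<Rightarrow> 'n::finite mpoly) \<Rightarrow> ((real^'n) \<times> real \<times> (real^'m)) set" where
  "supporting_triples g = {(a, b, lam). a \<noteq> 0 \<and> (\<forall>k. 0 \<le> lam $ k) \<and>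
     feasible_set g \<subseteq> {x. b \<le> a \<bullet> x} \<and>
     (\<exists>u\<in>frontier (feasible_set g). a \<bullet> u = b \<and>
        a = (\<Sum>k\<in>UNIV. lam $ k *\<^sub>R gradient (g k) u) \<and>
        (\<forall>k. lam $ k * eval_mpoly (g k) u = 0))}"

definition decomposition ::
  "('m::finite \<Rightarrow> 'n::finite mpoly) \<Rightarrow> ('k::finite \<Rightarrow> 'n set) \<Rightarrow>
   ((real^'n) \<times> real \<times> (real^'m) \<Rightarrow> 'k \<Rightarrow> 'n mpoly) \<Rightarrow> bool" where
  "decomposition g I \<phi> \<longleftrightarrow> (\<forall>(a, b, lam) \<in> supporting_triples g.
     (\<forall>i. only_variables (I i) (\<phi> (a, b, lam) i)) \<and>
     (\<Sum>j\<in>UNIV. Const (a $ j) * Var j) - Const b - (\<Sum>k\<in>UNIV. Const (lam $ k) * g k)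
       = (\<Sum>i\<in>UNIV. \<phi> (a, b, lam) i))"

definition real_exponent :: "nat^'n::finite \<Rightarrow> real^'n" where
  "real_exponent \<alpha> = (\<chi> j. real (\<alpha> $ j))"

definition half_exponents ::
  "('m::finite \<Rightarrow> 'n::finite mpoly) \<Rightarrow>
   ((real^'n) \<times> real \<times> (real^'m) \<Rightarrow> 'k \<Rightarrow> 'n mpoly) \<Rightarrow> 'k::finite \<Rightarrow> (nat^'n) set" where
  "half_exponents g \<phi> i = {\<alpha>. real_exponent \<alpha> \<in> convex hull
     ((\<lambda>v. (1/2) *\<^sub>R v) ` ({0} \<union> (\<Union>t\<in>supporting_triples g. real_exponent ` Poly_Mapping.keys (\<phi> t i))))}"

definition half_degree :: "('m::finite \<Rightarrow> 'n::finite mpoly) \<Rightarrow> nat" where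
  "half_degree g = (LEAST d. 1 \<le> d \<and> (\<forall>k. total_degree (g k) \<le> 2 * d))"

text \<open>
  Replaces every monomial \<open>x\<^sup>\<alpha>\<close> with \<open>1 < \<bar>\<alpha>\<bar> \<le> 2d\<close> by \<open>y\<^sub>\<alpha>\<close>; the polynomial is meant to
  have degree at most \<open>2d\<close>, with only the variables in \<open>J\<close> occurring in its linear part.
\<close>

definition linearize ::
  "nat \<Rightarrow> 'n set \<Rightarrow> 'n::finite mpoly \<Rightarrow> real^'n \<Rightarrow> (nat^'n \<Rightarrow> real) \<Rightarrow> real" where
  "linearize d J p x y = Poly_Mapping.lookup p 0 + (\<Sum>j\<in>J. x $ j * Poly_Mapping.lookup p (axis j 1))
     + (\<Sum>\<alpha> | 1 < mdeg \<alpha> \<and> mdeg \<alpha> \<le> 2 * d. y \<alpha> * Poly_Mapping.lookup p \<alpha>)"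

text \<open>Linearizes entrywise the matrix of pairwise products of the monomials with exponents in \<open>F\<close>.\<close>

definition moment_matrix ::
  "nat \<Rightarrow> 'n set \<Rightarrow> real^'n \<Rightarrow> (nat^'n \<Rightarrow> real) \<Rightarrow> nat^'n::finite \<Rightarrow> nat^'n \<Rightarrow> real" where
  "moment_matrix d J x y = (\<lambda>\<beta> \<gamma>. linearize d J (Mon \<beta> * Mon \<gamma>) x y)"

text \<open>Only the values of \<open>y\<close> at exponents of degree between 2 and \<open>2d\<close> are used.\<close>

definition sparse_lift ::
  "('m::finite \<Rightarrow> 'n::finite mpoly) \<Rightarrow> ('k::finite \<Rightarrow> 'n set) \<Rightarrow>
   ((real^'n) \<times> real \<times> (real^'m) \<Rightarrow> 'k \<Rightarrow> 'n mpoly) \<Rightarrow> (real^'n) set" where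
  "sparse_lift g I \<phi> = {x. \<exists>y :: nat^'n \<Rightarrow> real.
     (\<forall>k. 0 \<le> linearize (half_degree g) UNIV (g k) x y) \<and>
     (\<forall>i. psd_on (half_exponents g \<phi> i) (moment_matrix (half_degree g) (I i) x y))}"

lemma finite_mdeg_le: "finite {\<alpha> :: nat^'n::finite. mdeg \<alpha> \<le> N}"
proof -
  have "{\<alpha> :: nat^'n. mdeg \<alpha> \<le> N} \<subseteq> vec_lambda ` (UNIV \<rightarrow>\<^sub>E {..N})"
  proof
    fix \<alpha> :: "nat^'n" assume a: "\<alpha> \<in> {\<alpha>. mdeg \<alpha> \<le> N}"
    have "\<alpha> $ i \<le> N" for i
    proof -
      have "\<alpha> $ i \<le> mdeg \<alpha>" unfolding mdeg_def by (rule member_le_sum) auto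
      then show ?thesis using a by simp
    qed
    then show "\<alpha> \<in> vec_lambda ` (UNIV \<rightarrow>\<^sub>E {..N})"
      by (intro image_eqI[where x = "vec_nth \<alpha>"]) auto
  qed
  then show ?thesis by (rule finite_subset) (intro finite_imageI finite_PiE, auto)
qed

end

theory Submission
  imports Defs
begin

text \<open>
  Let \<open>S\<close> be the feasible set and \<open>L\<close> the lift. A point \<open>x\<close> of \<open>S\<close> lies in \<open>L\<close> because \<open>y\<^sub>\<alpha> = x\<^sup>\<alpha>\<close> turns
  the linearized constraints into the \<open>g\<^sub>k(x)\<close> and the moment matrices into matrices of rank at most one. For this
  the products of two monomials with exponents in \<open>F\<^sub>i\<close> must have degree at most \<open>2d\<close>
  (\<open>half_exponents_bounds\<close>): the \<open>\<phi>\<close> involve disjoint groups of variables, so there is no cancellation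
  between their nonconstant terms, and their degrees do not exceed that of the Lagrangian \<open>a\<^sup>T x - b - \<Sum> \<lambda>\<^sub>k g\<^sub>k\<close>.

  Conversely suppose that some point of \<open>L\<close> is not in the closed convex set \<open>S\<close>. The hyperplane through the closest
  point \<open>u\<close> of \<open>S\<close> separates strictly, and \<open>lagrange_multipliers\<close> completes it to a supporting
  triple. Its Lagrangian is an sos-convex polynomial that vanishes at \<open>u\<close> together with its gradient, and the same holds for
  each of its summands \<open>\<phi>\<^sub>i\<close> after subtraction of the constant \<open>\<phi>\<^sub>i(u)\<close>. Three facts show that the
  linearization of the Lagrangian is nonnegative on \<open>L\<close>, which contradicts the strict separation.

    \<^item> An sos-convex polynomial that vanishes at a point together with its gradient is a sum of squares
      (\<open>sos_convex_sum_of_squares\<close>). The classical reason is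
      \<open>f(x) = \<integral> (1 - s) \<bar>W(u + s (x - u)) (x - u)\<bar>\<^sup>2 ds\<close> over \<open>[0, 1]\<close>. Here, after a translation to \<open>u = 0\<close>, the
      integral is evaluated on monomials by Euler's identity, and the resulting positive semidefinite kernel
      \<open>1 / ((n + m)(n + m - 1))\<close> is factorized explicitly (\<open>hessian_kernel_gram\<close>).

    \<^item> The exponents of the squared polynomials lie in half the Newton polytope of the sum
      (\<open>newton_polytope_sum_of_squares\<close>), hence in \<open>F\<^sub>i\<close>.

    \<^item> The linearization of a square \<open>q\<^sup>2\<close> with exponents of \<open>q\<close> in \<open>F\<^sub>i\<close> is a value of the quadratic form of
      the \<open>i\<close>-th moment matrix (\<open>linearize_square_nonneg\<close>).

  Convexity of \<open>S\<close> comes from the tangent inequality \<open>sos_convex_tangent\<close>, another consequence of the first fact,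
  and the semidefinite representation collects all constraints of \<open>L\<close> in one block diagonal matrix.
\<close>

section \<open>Polynomials: evaluation, translation and derivatives\<close>

\<comment> \<open>The degree-one exponents are written \<open>axis j 1\<close> throughout; unfolding this \<open>1\<close> to \<open>Suc 0\<close>
  would keep the rewrite rules about variables from matching.\<close>
declare One_nat_def [simp del]

lemma mpoly_sum_monomials:
  "p = (\<Sum>\<alpha>\<in>Poly_Mapping.keys p. Poly_Mapping.single \<alpha> (Poly_Mapping.lookup p \<alpha>))"
  by (rule poly_mapping_eqI)
     (auto simp: lookup_sum lookup_single when_def in_keys_iff sum.delta)

lemma mpoly_induct_add [case_names zero monomial add]:
  fixes p :: "'n::finite mpoly"
  assumes "P 0" and "\<And>\<alpha> c. P (Poly_Mapping.single \<alpha> c)"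
    and "\<And>p q. P p \<Longrightarrow> P q \<Longrightarrow> P (p + q)"
  shows "P p"
proof -
  have "P (\<Sum>\<alpha>\<in>A. Poly_Mapping.single \<alpha> (Poly_Mapping.lookup p \<alpha>))" if "finite A" for A
    using that by (induction A) (auto intro: assms)
  from this[OF finite_keys[of p]] show ?thesis by (simp only: mpoly_sum_monomials[symmetric])
qed

lemma single_mult_Const [simp]:
  "Const c * Poly_Mapping.single \<alpha> d = Poly_Mapping.single \<alpha> (c * d)"
  by (simp add: mult_single)

lemma lookup_Const_mult [simp]:
  "Poly_Mapping.lookup (Const c * p) \<alpha> = c * Poly_Mapping.lookup p \<alpha>"
proof (induction p rule: mpoly_induct_add)
  case (add p q)
  then show ?case by (simp add: distrib_left lookup_add)
qed (simp_all add: lookup_single when_def)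

lemma Mon_sum:
  "finite A \<Longrightarrow> Mon (\<Sum>i\<in>A. f i) = (\<Prod>i\<in>A. Mon (f i) :: 'n::finite mpoly)"
proof (induction A rule: finite_induct)
  case (insert i A)
  have "Mon (f i + sum f A) = Mon (f i) * (Mon (sum f A) :: 'n mpoly)"
    by (simp add: mult_single)
  then show ?case using insert by simp
qed simp

lemma Mon_axis: "Mon (axis i n) = (Var i ^ n :: 'n::finite mpoly)"
proof (induction n)
  case 0
  have "axis i (0::nat) = (0 :: nat^'n)" by (simp add: axis_def vec_eq_iff)
  then show ?case by (simp add: \<open>axis i 0 = 0\<close>)
next
  case (Suc n)
  have "axis i (Suc n) = (axis i 1 + axis i n :: nat^'n)" by (auto simp: axis_def vec_eq_iff)
  then have "Mon (axis i (Suc n)) = Var i * (Mon (axis i n) :: 'n mpoly)"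
    by (simp add: mult_single)
  then show ?case using Suc by simp
qed

lemma Mon_eq_prod_Var: "Mon \<alpha> = (\<Prod>i\<in>UNIV. Var i ^ (\<alpha> $ i) :: 'n::finite mpoly)"
proof -
  have "\<alpha> = (\<Sum>i\<in>UNIV. axis i (\<alpha> $ i))"
    by (simp add: vec_eq_iff axis_def)
  then have "Mon \<alpha> = (Mon (\<Sum>i\<in>UNIV. axis i (\<alpha> $ i)) :: 'n mpoly)" by simp
  also have "\<dots> = (\<Prod>i\<in>UNIV. Mon (axis i (\<alpha> $ i)))" by (rule Mon_sum) simp
  also have "\<dots> = (\<Prod>i\<in>UNIV. Var i ^ (\<alpha> $ i))" by (rule prod.cong[OF refl Mon_axis])
  finally show ?thesis .
qed

text \<open>
  Constants and variables generate the polynomial ring. Hence two ring homomorphisms that agree on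
  them are equal, which is how most identities about evaluation and translation are proved.
\<close>

lemma mpoly_induct [case_names Const Var add mult]:
  fixes p :: "'n::finite mpoly"
  assumes C: "\<And>c. P (Const c)" and V: "\<And>j. P (Var j)"
    and A: "\<And>p q. P p \<Longrightarrow> P q \<Longrightarrow> P (p + q)" and M: "\<And>p q. P p \<Longrightarrow> P q \<Longrightarrow> P (p * q)"
  shows "P p"
proof (induction p rule: mpoly_induct_add)
  case zero
  then show ?case using C[of 0] by simp
next
  case (monomial \<alpha> c)
  have one: "P 1" using C[of 1] by simp
  have pw: "P (Var i ^ k)" for i k by (induction k) (auto intro: one M V)
  have "P (\<Prod>i\<in>B. Var i ^ (\<alpha> $ i))" if "finite B" for B
    using that by (induction B) (auto intro: one M pw)
  then have "P (Mon \<alpha>)" by (subst Mon_eq_prod_Var) simp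
  then have "P (Const c * Mon \<alpha>)" by (rule M[OF C])
  then show ?case by simp
qed (rule A)

text \<open>
  The homomorphism extending a map of the coefficients and a choice of images of the variables.
  Evaluation at a point and the change of variables \<open>x \<mapsto> x + u\<close> are both of this form.
\<close>

definition mpoly_hom :: "(real \<Rightarrow> 'a::comm_ring_1) \<Rightarrow> ('n \<Rightarrow> 'a) \<Rightarrow> 'n::finite mpoly \<Rightarrow> 'a" where
  "mpoly_hom h \<sigma> p =
     (\<Sum>\<alpha>\<in>Poly_Mapping.keys p. h (Poly_Mapping.lookup p \<alpha>) * (\<Prod>i\<in>UNIV. \<sigma> i ^ (\<alpha> $ i)))"

context
  fixes h :: "real \<Rightarrow> 'a::comm_ring_1" and \<sigma> :: "'n::finite \<Rightarrow> 'a"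
  assumes h_add: "\<And>c d. h (c + d) = h c + h d" and h_mult: "\<And>c d. h (c * d) = h c * h d"
    and h_one: "h 1 = 1"
begin

lemma coeff_map_zero: "h 0 = 0" using h_add[of 0 0] by simp

lemma mpoly_hom_single:
  "mpoly_hom h \<sigma> (Poly_Mapping.single \<alpha> c) = h c * (\<Prod>i\<in>UNIV. \<sigma> i ^ (\<alpha> $ i))"
  by (simp add: mpoly_hom_def coeff_map_zero)

lemma mpoly_hom_Const: "mpoly_hom h \<sigma> (Const c) = h c"
  by (simp add: mpoly_hom_single)

lemma mpoly_hom_Var: "mpoly_hom h \<sigma> (Var j) = \<sigma> j"
proof -
  have "(\<Prod>i\<in>UNIV. \<sigma> i ^ (axis j 1 $ i)) = (\<Prod>i\<in>UNIV. if i = j then \<sigma> i else 1)"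
    by (rule prod.cong) (auto simp: axis_def)
  then show ?thesis by (simp add: mpoly_hom_single h_one)
qed

lemma mpoly_hom_superset:
  assumes "finite A" "Poly_Mapping.keys p \<subseteq> A"
  shows "mpoly_hom h \<sigma> p = (\<Sum>\<alpha>\<in>A. h (Poly_Mapping.lookup p \<alpha>) * (\<Prod>i\<in>UNIV. \<sigma> i ^ (\<alpha> $ i)))"
  unfolding mpoly_hom_def by (rule sum.mono_neutral_left) (use assms in \<open>auto simp: in_keys_iff coeff_map_zero\<close>)

lemma mpoly_hom_add: "mpoly_hom h \<sigma> (p + q) = mpoly_hom h \<sigma> p + mpoly_hom h \<sigma> q"
proof -
  let ?A = "Poly_Mapping.keys p \<union> Poly_Mapping.keys q"
  show ?thesis
    using keys_add[of p q]
    by (simp add: mpoly_hom_superset[of ?A] lookup_add h_add distrib_right sum.distrib)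
qed

lemma mpoly_hom_mult: "mpoly_hom h \<sigma> (p * q) = mpoly_hom h \<sigma> p * mpoly_hom h \<sigma> q"
proof (induction p rule: mpoly_induct_add)
  case zero show ?case by (simp add: mpoly_hom_def)
next
  case (add p p')
  then show ?case by (simp add: distrib_right mpoly_hom_add)
next
  case (monomial \<alpha> c)
  show ?case
  proof (induction q rule: mpoly_induct_add)
    case zero show ?case by (simp add: mpoly_hom_def)
  next
    case (add p p')
    then show ?case by (simp add: distrib_left mpoly_hom_add)
  next
    case (monomial \<beta> d)
    then show ?case
      by (simp add: mult_single mpoly_hom_single h_mult power_add prod.distrib mult_ac)
  qed
qed

end

lemma eval_mpoly_hom: "eval_mpoly p x = mpoly_hom (\<lambda>c. c) (\<lambda>i. x $ i) p"
  by (simp add: eval_mpoly_def mpoly_hom_def eval_mon_def)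

lemma eval_Const [simp]: "eval_mpoly (Const c) x = c"
  and eval_Var [simp]: "eval_mpoly (Var j) x = x $ j"
  and eval_add [simp]: "eval_mpoly (p + q) x = eval_mpoly p x + eval_mpoly q x"
  and eval_mult [simp]: "eval_mpoly (p * q) x = eval_mpoly p x * eval_mpoly q x"
  unfolding eval_mpoly_hom
  by (rule mpoly_hom_Const mpoly_hom_Var mpoly_hom_add mpoly_hom_mult; rule refl)+

lemma eval_zero [simp]: "eval_mpoly 0 x = 0"
  by (simp add: eval_mpoly_def)

lemma eval_uminus [simp]: "eval_mpoly (- p) x = - eval_mpoly p x"
proof -
  have "eval_mpoly (- p) x + eval_mpoly p x = eval_mpoly 0 x"
    by (simp only: eval_add[symmetric] ab_left_minus)
  then show ?thesis by simp
qed

lemma eval_diff [simp]: "eval_mpoly (p - q) x = eval_mpoly p x - eval_mpoly q x"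
  using eval_add[of p "- q" x] by simp

lemma eval_sum [simp]: "eval_mpoly (\<Sum>i\<in>A. f i) x = (\<Sum>i\<in>A. eval_mpoly (f i) x)"
  by (induction A rule: infinite_finite_induct) auto

definition translate :: "real^'n \<Rightarrow> 'n::finite mpoly \<Rightarrow> 'n mpoly" where
  "translate u = mpoly_hom Const (\<lambda>i. Var i + Const (u $ i))"

lemma translate_Const [simp]: "translate u (Const c) = Const c"
  and translate_Var [simp]: "translate u (Var j) = Var j + Const (u $ j)"
  and translate_add [simp]: "translate u (p + q) = translate u p + translate u q"
  and translate_mult [simp]: "translate u (p * q) = translate u p * translate u q"
proof -
  have "Const (a + b) = Const a + Const b" for a b by (rule single_add)
  moreover have "Const (a * b) = Const a * Const b" for a b by simp
  moreover have "Const 1 = 1" by simp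
  ultimately have h: "(\<And>a b. Const (a + b) = Const a + Const b)"
    "(\<And>a b. Const (a * b) = Const a * Const b)" "Const 1 = 1" by blast+
  show "translate u (Const c) = Const c"
    unfolding translate_def by (rule mpoly_hom_Const[OF h])
  show "translate u (Var j) = Var j + Const (u $ j)"
    unfolding translate_def by (rule mpoly_hom_Var[OF h])
  show "translate u (p + q) = translate u p + translate u q"
    unfolding translate_def by (rule mpoly_hom_add[OF h])
  show "translate u (p * q) = translate u p * translate u q"
    unfolding translate_def by (rule mpoly_hom_mult[OF h])
qed

lemma translate_zero [simp]: "translate u 0 = 0"
  using translate_Const[of u 0] by (simp del: translate_Const)

lemma translate_translate [simp]: "translate (- u) (translate u p) = p"
proof (induction p rule: mpoly_induct)
  case (Var j)
  have "Const (- u $ j) + Const (u $ j) = 0" by (simp flip: single_add)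
  then show ?case by (simp add: add.assoc)
qed simp_all

lemma translate_sum_list: "translate u (\<Sum>q\<leftarrow>qs. f q) = (\<Sum>q\<leftarrow>qs. translate u (f q))"
  by (induction qs) auto

lemma eval_translate: "eval_mpoly (translate u p) x = eval_mpoly p (x + u)"
  by (induction p rule: mpoly_induct) auto

text \<open>
  Reading off coefficients replaces the truncated subtraction in the definition of the derivative
  by an addition.
\<close>

lemma lookup_partial_deriv:
  "Poly_Mapping.lookup (partial_deriv i p) \<alpha>
     = real (\<alpha> $ i + 1) * Poly_Mapping.lookup p (\<alpha> + axis i 1)"
proof -
  have eq: "Poly_Mapping.lookup (Poly_Mapping.single (\<beta> - axis i 1)
          (real (\<beta> $ i) * Poly_Mapping.lookup p \<beta>)) \<alpha> =
        (if \<beta> = \<alpha> + axis i 1 then real (\<alpha> $ i + 1) * Poly_Mapping.lookup p (\<alpha> + axis i 1) else 0)" for \<beta>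
  proof (cases "\<beta> $ i = 0")
    case True
    then have "\<beta> \<noteq> \<alpha> + axis i 1" by (auto simp: vec_eq_iff axis_def)
    then show ?thesis using True by simp
  next
    case False
    then have "\<beta> - axis i 1 = \<alpha> \<longleftrightarrow> \<beta> = \<alpha> + axis i 1"
      by (auto simp: vec_eq_iff axis_def)
    then show ?thesis by (auto simp: lookup_single when_def)
  qed
  show ?thesis
    unfolding partial_deriv_def lookup_sum eq by (auto simp: sum.delta in_keys_iff)
qed

lemma partial_deriv_single [simp]:
  "partial_deriv i (Poly_Mapping.single \<alpha> c) = Poly_Mapping.single (\<alpha> - axis i 1) (real (\<alpha> $ i) * c)"
  by (simp add: partial_deriv_def)

lemma partial_deriv_add [simp]: "partial_deriv i (p + q) = partial_deriv i p + partial_deriv i q"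
  by (rule poly_mapping_eqI) (simp add: lookup_partial_deriv lookup_add algebra_simps)

lemma partial_deriv_zero [simp]: "partial_deriv i 0 = 0"
  by (simp add: partial_deriv_def)

lemma partial_deriv_uminus [simp]: "partial_deriv i (- p) = - partial_deriv i p"
  by (rule poly_mapping_eqI) (simp add: lookup_partial_deriv)

lemma partial_deriv_diff [simp]: "partial_deriv i (p - q) = partial_deriv i p - partial_deriv i q"
  by (rule poly_mapping_eqI) (simp add: lookup_partial_deriv lookup_minus algebra_simps)

lemma partial_deriv_Const_mult [simp]: "partial_deriv i (Const c * p) = Const c * partial_deriv i p"
  by (rule poly_mapping_eqI) (simp add: lookup_partial_deriv)

lemma partial_deriv_sum [simp]: "partial_deriv i (\<Sum>k\<in>A. f k) = (\<Sum>k\<in>A. partial_deriv i (f k))"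
  by (induction A rule: infinite_finite_induct) auto

lemma partial_deriv_Const [simp]: "partial_deriv i (Const c) = 0"
  by simp

lemma partial_deriv_Var [simp]: "partial_deriv i (Var j) = Const (if i = j then 1 else 0)"
proof -
  have "axis j 1 - axis j 1 = (0::nat^'a)" by (simp add: vec_eq_iff)
  then show ?thesis by (auto simp: axis_def)
qed

lemma partial_deriv_mult:
  "partial_deriv i (p * q) = partial_deriv i p * q + p * partial_deriv i q"
proof (induction p rule: mpoly_induct_add)
  case zero show ?case by simp
next
  case (add p p')
  then show ?case by (simp add: algebra_simps)
next
  case (monomial \<alpha> c)
  show ?case
  proof (induction q rule: mpoly_induct_add)
    case zero show ?case by simp
  next
    case (add p p')
    then show ?case by (simp add: algebra_simps)
  next
    case (monomial \<beta> d)
    have a: "Poly_Mapping.single (\<alpha> - axis i 1 + \<beta>) (real (\<alpha> $ i) * c * d)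
        = Poly_Mapping.single (\<alpha> + \<beta> - axis i 1) (real (\<alpha> $ i) * c * d)"
    proof (cases "\<alpha> $ i = 0")
      case False
      then have "\<alpha> - axis i 1 + \<beta> = \<alpha> + \<beta> - axis i 1" by (auto simp: vec_eq_iff axis_def)
      then show ?thesis by simp
    qed simp
    have b: "Poly_Mapping.single (\<alpha> + (\<beta> - axis i 1)) (c * (real (\<beta> $ i) * d))
        = Poly_Mapping.single (\<alpha> + \<beta> - axis i 1) (c * (real (\<beta> $ i) * d))"
    proof (cases "\<beta> $ i = 0")
      case False
      then have "\<alpha> + (\<beta> - axis i 1) = \<alpha> + \<beta> - axis i 1" by (auto simp: vec_eq_iff axis_def)
      then show ?thesis by simp
    qed simp
    have "partial_deriv i (Poly_Mapping.single \<alpha> c * Poly_Mapping.single \<beta> d)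
        = Poly_Mapping.single (\<alpha> + \<beta> - axis i 1) (real (\<alpha> $ i) * c * d)
          + Poly_Mapping.single (\<alpha> + \<beta> - axis i 1) (c * (real (\<beta> $ i) * d))"
      by (simp add: mult_single algebra_simps flip: single_add)
    then show ?case
      by (simp only: partial_deriv_single mult_single a b)
  qed
qed

lemma partial_deriv_translate: "partial_deriv i (translate u p) = translate u (partial_deriv i p)"
  by (induction p rule: mpoly_induct) (simp_all add: partial_deriv_mult del: partial_deriv_single)

lemma eval_mpoly_at_0: "eval_mpoly p 0 = Poly_Mapping.lookup p 0"
proof (induction p rule: mpoly_induct_add)
  case (monomial \<alpha> c)
  have "(\<Prod>i\<in>UNIV. (0::real) ^ (\<alpha> $ i)) = (if \<alpha> = 0 then 1 else 0)"
    by (auto simp: vec_eq_iff)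
  then show ?case by (auto simp: eval_mpoly_def eval_mon_def lookup_single when_def)
qed (simp_all add: lookup_add)

text \<open>
  The bridge from the formal derivatives to calculus; it is only needed to see that the formal
  gradient vanishes at a minimum.
\<close>

lemma eval_mpoly_has_derivative_line:
  "((\<lambda>t. eval_mpoly p (u + t *\<^sub>R v)) has_real_derivative
      (\<Sum>i\<in>UNIV. v $ i * eval_mpoly (partial_deriv i p) (u + t *\<^sub>R v))) (at t)"
proof (induction p rule: mpoly_induct)
  case (Const c)
  then show ?case by (simp add: eval_mpoly_def[of 0])
next
  case (Var j)
  have "(\<Sum>i\<in>UNIV. v $ i * (if i = j then 1 else 0)) = v $ j"
    by (simp add: if_distrib cong: if_cong)
  then show ?case by (auto intro!: derivative_eq_intros simp del: partial_deriv_single)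
next
  case (add p q)
  from DERIV_add[OF this] show ?case by (simp add: sum.distrib algebra_simps)
next
  case (mult p q)
  from DERIV_mult[OF this] show ?case
    by (simp add: partial_deriv_mult sum.distrib sum_distrib_left sum_distrib_right algebra_simps)
qed

lemma continuous_eval_mpoly: "continuous_on A (eval_mpoly p)"
proof (induction p rule: mpoly_induct)
  case (Var j) then show ?case by (simp add: continuous_on_component continuous_on_id)
next
  case (add p q)
  then show ?case using continuous_on_add[OF add] by simp
next
  case (mult p q)
  then show ?case using continuous_on_mult[OF mult] by simp
qed simp

text \<open>
  Restricting to a line makes the finiteness of the roots of univariate polynomials available.
\<close>

lemma eval_mpoly_line_poly: "\<exists>q :: real poly. \<forall>t. eval_mpoly p (u + t *\<^sub>R v) = poly q t"
proof (induction p rule: mpoly_induct)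
  case (Const c)
  show ?case by (rule exI[of _ "[:c:]"]) simp
next
  case (Var j)
  show ?case by (rule exI[of _ "[:u $ j, v $ j:]"]) (simp add: mult_ac)
next
  case (add p q)
  then show ?case by (auto, metis poly_add)
next
  case (mult p q)
  then show ?case by (auto, metis poly_mult)
qed

section \<open>Sums of squares and sos-convexity\<close>

text \<open>
  Lists, rather than a number of squares together with a family, make closure under addition a
  matter of concatenation.
\<close>

definition sum_of_squares :: "'n::finite mpoly \<Rightarrow> bool" where
  "sum_of_squares p \<longleftrightarrow> (\<exists>qs. p = (\<Sum>q\<leftarrow>qs. q * q))"

lemma sum_of_squares_square: "sum_of_squares (q * q)"
  unfolding sum_of_squares_def by (rule exI[of _ "[q]"]) simp

lemma sum_of_squares_zero: "sum_of_squares 0"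
  unfolding sum_of_squares_def by (rule exI[of _ "[]"]) simp

lemma sum_of_squares_add: "sum_of_squares p \<Longrightarrow> sum_of_squares q \<Longrightarrow> sum_of_squares (p + q)"
  unfolding sum_of_squares_def
proof (elim exE)
  fix ps qs assume "p = (\<Sum>q\<leftarrow>ps. q * q)" "q = (\<Sum>q\<leftarrow>qs. q * q)"
  then show "\<exists>qs. p + q = (\<Sum>q\<leftarrow>qs. q * q)" by (intro exI[of _ "ps @ qs"]) simp
qed

lemma sum_of_squares_sum: "(\<And>i. i \<in> A \<Longrightarrow> sum_of_squares (f i)) \<Longrightarrow> sum_of_squares (\<Sum>i\<in>A. f i)"
  by (induction A rule: infinite_finite_induct) (auto intro: sum_of_squares_zero sum_of_squares_add)

lemma sum_of_squares_sum_list: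
  "(\<And>i. i \<in> set xs \<Longrightarrow> sum_of_squares (f i)) \<Longrightarrow> sum_of_squares (\<Sum>i\<leftarrow>xs. f i)"
  by (induction xs) (auto intro: sum_of_squares_zero sum_of_squares_add)

lemma sum_of_squares_translate: "sum_of_squares p \<Longrightarrow> sum_of_squares (translate u p)"
  unfolding sum_of_squares_def
proof (elim exE)
  fix qs assume "p = (\<Sum>q\<leftarrow>qs. q * q)"
  then show "\<exists>qs. translate u p = (\<Sum>q\<leftarrow>qs. q * q)"
    by (intro exI[of _ "map (translate u) qs"]) (simp add: translate_sum_list o_def)
qed

lemma sum_of_squares_nonneg: "sum_of_squares p \<Longrightarrow> 0 \<le> eval_mpoly p x"
proof -
  have "0 \<le> eval_mpoly (\<Sum>q\<leftarrow>qs. q * q) x" for qs :: "'a mpoly list"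
    by (induction qs) auto
  then show "sum_of_squares p \<Longrightarrow> ?thesis" by (auto simp: sum_of_squares_def)
qed

section \<open>An explicit factorization of the kernel of the double integral\<close>

text \<open>
  For positive nodes \<open>a\<^sub>0, a\<^sub>1, \<dots>\<close> the identity
  \<open>1 - (x - a)(y - a) / ((x + a)(y + a)) = 2a(x + y) / ((x + a)(y + a))\<close>
  splits off from \<open>1 / (x + y)\<close> a term of the form \<open>c(x) c(y)\<close>, and leaves \<open>1 / (x + y)\<close> multiplied by
  \<open>(x - a)(y - a) / ((x + a)(y + a))\<close>. Iteration gives a Cholesky factorization of the Cauchy kernel
  in closed form, whose remainder vanishes as soon as \<open>x\<close> is one of the nodes.
\<close>

lemma cauchy_kernel_telescope:
  fixes a :: "nat \<Rightarrow> real"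
  assumes "0 < x" "0 < y" "\<And>j. 0 < a j"
  defines "c \<equiv> \<lambda>j x. sqrt (2 * a j) / (x + a j) * (\<Prod>k<j. (x - a k) / (x + a k))"
  shows "1 / (x + y) = (\<Sum>j<N. c j x * c j y)
     + (\<Prod>k<N. (x - a k) / (x + a k)) * (\<Prod>k<N. (y - a k) / (y + a k)) / (x + y)"
proof (induction N)
  case (Suc N)
  define X where "X = (\<Prod>k<N. (x - a k) / (x + a k))"
  define Y where "Y = (\<Prod>k<N. (y - a k) / (y + a k))"
  have pos: "x + y \<noteq> 0" "x + a N \<noteq> 0" "y + a N \<noteq> 0" "0 < a N"
    using assms(1,2) assms(3)[of N] by linarith+
  have s: "c N x * c N y = 2 * a N / ((x + a N) * (y + a N)) * (X * Y)"
    using pos(4) unfolding c_def X_def[symmetric] Y_def[symmetric] by simp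
  have id: "1 / (x + y) = 2 * a N / ((x + a N) * (y + a N))
      + (x - a N) / (x + a N) * ((y - a N) / (y + a N)) / (x + y)"
    using pos(1-3) by (simp add: divide_simps) (simp add: algebra_simps)
  have "X * Y / (x + y) = X * Y * (1 / (x + y))" by simp
  also have "\<dots> = c N x * c N y + X * ((x - a N) / (x + a N)) * (Y * ((y - a N) / (y + a N))) / (x + y)"
    unfolding id s by (simp add: algebra_simps)
  finally show ?case using Suc by (simp add: X_def Y_def)
qed simp

text \<open>
  At the arguments \<open>n - \<theta>\<close> with \<open>1 \<le> n \<le> N\<close>, choosing these same numbers as nodes kills the
  remainder after \<open>N\<close> terms.
\<close>

lemma cauchy_kernel_gram:
  fixes \<theta> :: real
  assumes "0 \<le> \<theta>" "\<theta> < 1"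
  obtains c :: "nat \<Rightarrow> nat \<Rightarrow> real" where
    "\<And>n m. 1 \<le> n \<Longrightarrow> n \<le> N \<Longrightarrow> 1 \<le> m \<Longrightarrow> m \<le> N \<Longrightarrow>
       1 / (real n + real m - 2 * \<theta>) = (\<Sum>j<N. c j n * c j m)"
proof
  define a where "a j = real (Suc j) - \<theta>" for j
  define c where "c j n = sqrt (2 * a j) / ((real n - \<theta>) + a j)
      * (\<Prod>k<j. ((real n - \<theta>) - a k) / ((real n - \<theta>) + a k))" for j n
  fix n m assume nm: "1 \<le> n" "n \<le> N" "1 \<le> m" "m \<le> N"
  have pos: "0 < real n - \<theta>" "0 < real m - \<theta>"
    using nm assms by auto
  have a: "0 < a j" for j
    using assms by (simp add: a_def)
  \<comment> \<open>The nodes are numbered from \<open>0\<close>, so that \<open>n - \<theta>\<close> is the node with index \<open>n - 1\<close>.\<close>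
  have "\<exists>k<N. real n - \<theta> - a k = 0"
    using nm by (intro exI[of _ "n - 1"]) (auto simp: a_def of_nat_diff)
  then have zero: "(\<Prod>k<N. ((real n - \<theta>) - a k) / ((real n - \<theta>) + a k)) = 0"
    by (auto simp: prod_zero_iff)
  have "1 / (real n + real m - 2 * \<theta>) = 1 / ((real n - \<theta>) + (real m - \<theta>))"
    by (simp add: algebra_simps)
  also have "\<dots> = (\<Sum>j<N. c j n * c j m)"
    using cauchy_kernel_telescope[OF pos, of a, OF a, where N = N] unfolding zero by (simp add: c_def)
  finally show "1 / (real n + real m - 2 * \<theta>) = (\<Sum>j<N. c j n * c j m)" .
qed

text \<open>
  With \<open>k = n + m\<close>, the kernel \<open>1 / (k (k - 1))\<close> is \<open>\<integral> (1 - s) s\<^bsup>k-2\<^esup> ds\<close> over \<open>[0, 1]\<close>, the factor by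
  which integrating the Hessian twice along a ray from the origin multiplies the terms of degree \<open>k\<close>.
  It is positive semidefinite on positive integers, being the entrywise product of the Cauchy kernels
  \<open>1 / (n + m)\<close> and \<open>1 / ((n - 1/2) + (m - 1/2))\<close>; the products of the factors of these two factorize
  it as a finite sum, so that no integral has to be taken.
\<close>

lemma hessian_kernel_gram:
  obtains e :: "nat \<times> nat \<Rightarrow> nat \<Rightarrow> real" where
    "\<And>n m. 1 \<le> n \<Longrightarrow> n \<le> N \<Longrightarrow> 1 \<le> m \<Longrightarrow> m \<le> N \<Longrightarrow>
       1 / ((real n + real m) * (real n + real m - 1)) = (\<Sum>t\<in>{..<N} \<times> {..<N}. e t n * e t m)"
proof -
  obtain c where c: "\<And>n m. 1 \<le> n \<Longrightarrow> n \<le> N \<Longrightarrow> 1 \<le> m \<Longrightarrow> m \<le> N \<Longrightarrow>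
       1 / (real n + real m - 2 * 0) = (\<Sum>j<N. c j n * c j m)"
    using cauchy_kernel_gram[where \<theta> = 0 and N = N] by auto
  obtain d where d: "\<And>n m. 1 \<le> n \<Longrightarrow> n \<le> N \<Longrightarrow> 1 \<le> m \<Longrightarrow> m \<le> N \<Longrightarrow>
       1 / (real n + real m - 2 * (1/2)) = (\<Sum>j<N. d j n * d j m)"
    using cauchy_kernel_gram[where \<theta> = "1/2" and N = N] by auto
  have "1 / ((real n + real m) * (real n + real m - 1))
      = (\<Sum>(j,k)\<in>{..<N} \<times> {..<N}. (c j n * d k n) * (c j m * d k m))"
    if "1 \<le> n" "n \<le> N" "1 \<le> m" "m \<le> N" for n m
  proof -
    have "1 / ((real n + real m) * (real n + real m - 1)) =
      (1 / (real n + real m - 2 * 0)) * (1 / (real n + real m - 2 * (1/2)))" by simp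
    also have "\<dots> = (\<Sum>j<N. c j n * c j m) * (\<Sum>j<N. d j n * d j m)"
      unfolding c[OF that] d[OF that] ..
    finally show ?thesis
      by (simp add: sum_product sum.cartesian_product mult_ac)
  qed
  then show thesis
    by (intro that[of "\<lambda>(j,k) n. c j n * d k n"]) (simp add: case_prod_unfold)
qed

section \<open>Vanishing sos-convex polynomials are sums of squares\<close>

lemma mdeg_zero_iff: "mdeg \<alpha> = 0 \<longleftrightarrow> \<alpha> = 0"
  by (auto simp: mdeg_def vec_eq_iff)

lemma mdeg_zero [simp]: "mdeg 0 = 0"
  by (simp add: mdeg_zero_iff)

lemma mdeg_add [simp]: "mdeg (\<alpha> + \<beta>) = mdeg \<alpha> + mdeg \<beta>"
  by (simp add: mdeg_def sum.distrib)

lemma mdeg_axis [simp]: "mdeg (axis i k) = k"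
  by (simp add: mdeg_def axis_def)

lemma mdeg_one_cases:
  assumes "mdeg \<alpha> = 1" obtains j where "\<alpha> = axis j 1"
proof -
  from assms have "\<alpha> \<noteq> 0" by auto
  then obtain j where j: "\<alpha> $ j \<noteq> 0" by (auto simp: vec_eq_iff)
  have "\<alpha> = (\<alpha> - axis j 1) + axis j 1" using j by (auto simp: vec_eq_iff axis_def)
  then have "mdeg (\<alpha> - axis j 1) = 0" using assms by (metis add_cancel_left_left mdeg_add mdeg_axis)
  then have "\<alpha> - axis j 1 = 0" by (simp add: mdeg_zero_iff)
  then show thesis using \<open>\<alpha> = (\<alpha> - axis j 1) + axis j 1\<close> that by (metis add_0)
qed

lemma lookup_Var_mult:
  "Poly_Mapping.lookup (Var i * p) \<alpha> = (if \<alpha> $ i = 0 then 0 else Poly_Mapping.lookup p (\<alpha> - axis i 1))"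
proof (induction p rule: mpoly_induct_add)
  case (add p q)
  then show ?case by (simp add: distrib_left lookup_add)
next
  case (monomial \<beta> c)
  have "axis i 1 + \<beta> = \<alpha> \<longleftrightarrow> \<alpha> $ i \<noteq> 0 \<and> \<beta> = \<alpha> - axis i 1"
    by (auto simp: vec_eq_iff axis_def)
  then show ?case by (auto simp: mult_single lookup_single when_def)
qed simp

lemma lookup_Var_mult_partial_deriv:
  "Poly_Mapping.lookup (Var i * partial_deriv i p) \<alpha> = real (\<alpha> $ i) * Poly_Mapping.lookup p \<alpha>"
proof (cases "\<alpha> $ i = 0")
  case False
  then have "\<alpha> - axis i 1 + axis i 1 = \<alpha>" "(\<alpha> - axis i 1) $ i + 1 = \<alpha> $ i"
    by (auto simp: vec_eq_iff axis_def)
  then show ?thesis using False by (simp add: lookup_Var_mult lookup_partial_deriv)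
qed (simp add: lookup_Var_mult)

text \<open>
  Euler's identity in second order: \<open>x\<^sup>T (\<nabla>\<^sup>2 p) x\<close> multiplies the coefficient of a monomial of degree
  \<open>k\<close> by \<open>k (k - 1)\<close>.
\<close>

lemma lookup_euler_hessian:
  "Poly_Mapping.lookup (\<Sum>i\<in>UNIV. \<Sum>j\<in>UNIV. Var i * Var j * partial_deriv i (partial_deriv j p)) \<alpha>
     = real (mdeg \<alpha>) * (real (mdeg \<alpha>) - 1) * Poly_Mapping.lookup p \<alpha>"
proof -
  have "Poly_Mapping.lookup (Var i * Var j * partial_deriv i (partial_deriv j p)) \<alpha>
    = (real (\<alpha> $ i) - (if i = j then 1 else 0)) * real (\<alpha> $ j) * Poly_Mapping.lookup p \<alpha>" for i j
  proof (cases "\<alpha> $ j = 0")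
    case True
    then show ?thesis by (simp add: mult.left_commute[of "Var i"] mult.assoc lookup_Var_mult)
  next
    case False
    then have a: "\<alpha> - axis j 1 + axis j 1 = \<alpha>" "(\<alpha> - axis j 1) $ j + 1 = \<alpha> $ j"
      "real ((\<alpha> - axis j 1) $ i) = real (\<alpha> $ i) - (if i = j then 1 else 0)"
      by (auto simp: vec_eq_iff axis_def of_nat_diff)
    have "Poly_Mapping.lookup (Var j * (Var i * partial_deriv i (partial_deriv j p))) \<alpha>
       = Poly_Mapping.lookup (Var i * partial_deriv i (partial_deriv j p)) (\<alpha> - axis j 1)"
      using False by (simp add: lookup_Var_mult[of j])
    also have "\<dots> = (real (\<alpha> $ i) - (if i = j then 1 else 0)) * (real (\<alpha> $ j) * Poly_Mapping.lookup p \<alpha>)"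
      by (simp only: lookup_Var_mult_partial_deriv lookup_partial_deriv a)
    finally show ?thesis by (simp add: mult_ac)
  qed
  then have "Poly_Mapping.lookup (\<Sum>i\<in>UNIV. \<Sum>j\<in>UNIV. Var i * Var j * partial_deriv i (partial_deriv j p)) \<alpha>
    = (\<Sum>i\<in>UNIV. \<Sum>j\<in>UNIV. (real (\<alpha> $ i) - (if i = j then 1 else 0)) * real (\<alpha> $ j) * Poly_Mapping.lookup p \<alpha>)"
    by (simp only: lookup_sum)
  also have "\<dots> = (\<Sum>i\<in>UNIV. \<Sum>j\<in>UNIV. real (\<alpha> $ i) * real (\<alpha> $ j) * Poly_Mapping.lookup p \<alpha>
      - (if i = j then real (\<alpha> $ j) * Poly_Mapping.lookup p \<alpha> else 0))"
    by (intro sum.cong refl) (auto simp: algebra_simps)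
  also have "\<dots> = (\<Sum>i\<in>UNIV. \<Sum>j\<in>UNIV. real (\<alpha> $ i) * real (\<alpha> $ j)) * Poly_Mapping.lookup p \<alpha>
      - (\<Sum>i\<in>UNIV. real (\<alpha> $ i)) * Poly_Mapping.lookup p \<alpha>"
    by (simp add: sum_subtractf sum_distrib_right)
  also have "\<dots> = real (mdeg \<alpha>) * (real (mdeg \<alpha>) - 1) * Poly_Mapping.lookup p \<alpha>"
    by (simp add: mdeg_def left_diff_distrib right_diff_distrib flip: sum_product)
  finally show ?thesis .
qed

lemma square_expansion:
  fixes q :: "'n::finite mpoly"
  assumes "finite A" "Poly_Mapping.keys q \<subseteq> A"
  shows "q * q = (\<Sum>\<beta>\<in>A. \<Sum>\<gamma>\<in>A. Poly_Mapping.single (\<beta> + \<gamma>) (Poly_Mapping.lookup q \<beta> * Poly_Mapping.lookup q \<gamma>))"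
proof -
  have "q = (\<Sum>\<alpha>\<in>A. Poly_Mapping.single \<alpha> (Poly_Mapping.lookup q \<alpha>))"
    by (subst mpoly_sum_monomials[of q], rule sum.mono_neutral_left) (use assms in \<open>auto simp: in_keys_iff\<close>)
  then have "q * q = (\<Sum>\<alpha>\<in>A. Poly_Mapping.single \<alpha> (Poly_Mapping.lookup q \<alpha>))
      * (\<Sum>\<alpha>\<in>A. Poly_Mapping.single \<alpha> (Poly_Mapping.lookup q \<alpha>))" by (intro arg_cong2[of q _ q _ "(*)"])
  then show ?thesis by (simp add: sum_product mult_single)
qed

lemma sos_convex_iff_list:
  "sos_convex f \<longleftrightarrow> (\<exists>ws. \<forall>i j. partial_deriv i (partial_deriv j f) = (\<Sum>w\<leftarrow>ws. w i * w j))"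
proof
  assume "sos_convex f"
  then obtain r and W :: "nat \<Rightarrow> 'a \<Rightarrow> 'a mpoly"
    where "\<forall>i j. partial_deriv i (partial_deriv j f) = (\<Sum>l<r. W l i * W l j)"
    by (auto simp: sos_convex_def)
  then show "\<exists>ws. \<forall>i j. partial_deriv i (partial_deriv j f) = (\<Sum>w\<leftarrow>ws. w i * w j)"
    by (intro exI[of _ "map W [0..<r]"]) (simp add: interv_sum_list_conv_sum_set_nat o_def atLeast0LessThan)
next
  assume "\<exists>ws. \<forall>i j. partial_deriv i (partial_deriv j f) = (\<Sum>w\<leftarrow>ws. w i * w j)"
  then obtain ws where "\<forall>i j. partial_deriv i (partial_deriv j f) = (\<Sum>w\<leftarrow>ws. w i * w j)" by blast
  then show "sos_convex f" unfolding sos_convex_def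
    by (intro exI[of _ "length ws"] exI[of _ "\<lambda>l. ws ! l"]) (simp add: sum_list_sum_nth atLeast0LessThan)
qed

lemma sos_convex_add:
  assumes "sos_convex f" "sos_convex g" shows "sos_convex (f + g)"
proof -
  obtain ws vs where "\<forall>i j. partial_deriv i (partial_deriv j f) = (\<Sum>w\<leftarrow>ws. w i * w j)"
    "\<forall>i j. partial_deriv i (partial_deriv j g) = (\<Sum>w\<leftarrow>vs. w i * w j)"
    using assms by (auto simp: sos_convex_iff_list)
  then show ?thesis unfolding sos_convex_iff_list by (intro exI[of _ "ws @ vs"]) simp
qed

lemma sos_convex_scale:
  assumes "sos_convex f" "0 \<le> c" shows "sos_convex (Const c * f)"
proof -
  obtain ws where ws: "\<forall>i j. partial_deriv i (partial_deriv j f) = (\<Sum>w\<leftarrow>ws. w i * w j)"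
    using assms by (auto simp: sos_convex_iff_list)
  have eq: "Const (sqrt c) * Const (sqrt c) = (Const c :: 'a mpoly)" using assms by simp
  have "Const (sqrt c) * a * (Const (sqrt c) * b) = Const c * (a * b)" for a b :: "'a mpoly"
    unfolding eq[symmetric] by (simp only: mult_ac)
  then have "Const c * (\<Sum>w\<leftarrow>ws. w i * w j)
      = (\<Sum>w\<leftarrow>map (\<lambda>w i. Const (sqrt c) * w i) ws. w i * w j)" for i j
    by (simp only: map_map o_def sum_list_const_mult)
  then show ?thesis unfolding sos_convex_iff_list using ws
    by (intro exI[of _ "map (\<lambda>w i. Const (sqrt c) * w i) ws"]) simp
qed

lemma sos_convex_affine:
  assumes "\<And>i j. partial_deriv i (partial_deriv j f) = 0" shows "sos_convex f"
  unfolding sos_convex_iff_list by (rule exI[of _ "[]"]) (simp add: assms)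

lemma sos_convex_sum: "(\<And>i. i \<in> A \<Longrightarrow> sos_convex (f i)) \<Longrightarrow> sos_convex (\<Sum>i\<in>A. f i)"
  by (induction A rule: infinite_finite_induct) (auto intro: sos_convex_affine sos_convex_add)

lemma sos_convex_translate:
  assumes "sos_convex f" shows "sos_convex (translate u f)"
proof -
  obtain ws where ws: "\<forall>i j. partial_deriv i (partial_deriv j f) = (\<Sum>w\<leftarrow>ws. w i * w j)"
    using assms by (auto simp: sos_convex_iff_list)
  show ?thesis unfolding sos_convex_iff_list using ws
    by (intro exI[of _ "map (\<lambda>w i. translate u (w i)) ws"])
       (simp add: partial_deriv_translate translate_sum_list o_def)
qed

text \<open>
  With \<open>\<nabla>\<^sup>2 f = W\<^sup>T W\<close>, the polynomial \<open>x\<^sup>T (\<nabla>\<^sup>2 f) x = \<bar>W x\<bar>\<^sup>2\<close> is a sum of squares, and by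
  Euler's identity \<open>f\<close> is obtained from it by dividing the terms of degree \<open>k\<close> by \<open>k (k - 1)\<close>; nothing
  is lost because \<open>f\<close> has no terms of degree \<open>0\<close> and \<open>1\<close>. On the product of two monomials of degrees \<open>n\<close>
  and \<open>m\<close> this division is multiplication by the kernel factorized in
  \<open>hessian_kernel_gram\<close>, so it turns each square into a finite sum of squares.
\<close>

lemma sos_convex_sum_of_squares_at_0:
  fixes f :: "'n::finite mpoly"
  assumes "sos_convex f" and f0: "Poly_Mapping.lookup f 0 = 0"
    and f1: "\<And>i. Poly_Mapping.lookup f (axis i 1) = 0"
  shows "sum_of_squares f"
proof -
  obtain ws where ws: "\<And>i j. partial_deriv i (partial_deriv j f) = (\<Sum>w\<leftarrow>ws. w i * w j)"
    using assms(1) by (auto simp: sos_convex_iff_list)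
  \<comment> \<open>The entries \<open>r w\<close> of the vector \<open>W x\<close> have no constant term, so that the degrees to which
    the kernel is applied are positive.\<close>
  define r where "r w = (\<Sum>i\<in>UNIV. Var i * w i)" for w :: "'n \<Rightarrow> 'n mpoly"
  have r0: "Poly_Mapping.lookup (r w) 0 = 0" for w
    by (simp add: r_def lookup_sum lookup_Var_mult)
  define A where "A = (\<Union>w\<in>set ws. Poly_Mapping.keys (r w))"
  have finA: "finite A" by (simp add: A_def)
  define N where "N = Max (insert 0 (mdeg ` A))"
  have N: "1 \<le> mdeg \<alpha>" "mdeg \<alpha> \<le> N" if "\<alpha> \<in> A" for \<alpha>
  proof -
    show "mdeg \<alpha> \<le> N" unfolding N_def using that finA by (intro Max_ge) auto
    have "\<alpha> \<noteq> 0" using that r0 by (auto simp: A_def in_keys_iff)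
    then have "mdeg \<alpha> \<noteq> 0" by (simp add: mdeg_zero_iff)
    then show "1 \<le> mdeg \<alpha>" by linarith
  qed
  obtain e :: "nat \<times> nat \<Rightarrow> nat \<Rightarrow> real" where e:
    "\<And>n m. 1 \<le> n \<Longrightarrow> n \<le> N \<Longrightarrow> 1 \<le> m \<Longrightarrow> m \<le> N \<Longrightarrow>
       1 / ((real n + real m) * (real n + real m - 1)) = (\<Sum>t\<in>{..<N} \<times> {..<N}. e t n * e t m)"
    using hessian_kernel_gram by blast
  define c where "c w \<alpha> = Poly_Mapping.lookup (r w) \<alpha>" for w \<alpha>
  \<comment> \<open>Each factor \<open>e t\<close> of the kernel reweights the monomials of \<open>r w\<close> according to their degree.\<close>
  define q where "q w t = (\<Sum>\<alpha>\<in>A. Poly_Mapping.single \<alpha> (e t (mdeg \<alpha>) * c w \<alpha>))" for w t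
  have "(\<Sum>i\<in>UNIV. \<Sum>j\<in>UNIV. Var i * Var j * (w i * w j)) = r w * r w" for w
    unfolding r_def sum_product by (simp add: mult_ac)
  then have E: "(\<Sum>i\<in>UNIV. \<Sum>j\<in>UNIV. Var i * Var j * partial_deriv i (partial_deriv j f))
      = (\<Sum>w\<leftarrow>ws. r w * r w)"
    unfolding ws by (induction ws) (simp_all add: distrib_left sum.distrib)
  have sq: "r w * r w = (\<Sum>\<beta>\<in>A. \<Sum>\<gamma>\<in>A. Poly_Mapping.single (\<beta> + \<gamma>) (c w \<beta> * c w \<gamma>))" if "w \<in> set ws" for w
    unfolding c_def by (rule square_expansion) (use that finA in \<open>auto simp: A_def\<close>)
  have qq: "(\<Sum>t\<in>{..<N}\<times>{..<N}. q w t * q w t) = (\<Sum>\<beta>\<in>A. \<Sum>\<gamma>\<in>A. Poly_Mapping.single (\<beta> + \<gamma>)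
      (1 / ((real (mdeg \<beta>) + real (mdeg \<gamma>)) * (real (mdeg \<beta>) + real (mdeg \<gamma>) - 1)) * (c w \<beta> * c w \<gamma>)))" for w
  proof -
    have "(\<Sum>t\<in>{..<N}\<times>{..<N}. q w t * q w t) = (\<Sum>t\<in>{..<N}\<times>{..<N}. \<Sum>\<beta>\<in>A. \<Sum>\<gamma>\<in>A.
        Poly_Mapping.single (\<beta> + \<gamma>) (e t (mdeg \<beta>) * e t (mdeg \<gamma>) * (c w \<beta> * c w \<gamma>)))"
      unfolding q_def sum_product by (simp add: mult_single mult_ac)
    also have "\<dots> = (\<Sum>\<beta>\<in>A. \<Sum>\<gamma>\<in>A. \<Sum>t\<in>{..<N}\<times>{..<N}.
        Poly_Mapping.single (\<beta> + \<gamma>) (e t (mdeg \<beta>) * e t (mdeg \<gamma>) * (c w \<beta> * c w \<gamma>)))"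
      by (subst sum.swap, rule sum.cong[OF refl], rule sum.swap)
    also have "\<dots> = (\<Sum>\<beta>\<in>A. \<Sum>\<gamma>\<in>A. Poly_Mapping.single (\<beta> + \<gamma>)
        ((\<Sum>t\<in>{..<N}\<times>{..<N}. e t (mdeg \<beta>) * e t (mdeg \<gamma>)) * (c w \<beta> * c w \<gamma>)))"
      by (intro sum.cong refl poly_mapping_eqI) (simp add: lookup_sum lookup_single when_def sum_distrib_right)
    finally show ?thesis by (simp add: e N)
  qed
  have "f = (\<Sum>w\<leftarrow>ws. \<Sum>t\<in>{..<N}\<times>{..<N}. q w t * q w t)"
  proof (rule poly_mapping_eqI)
    fix \<alpha> :: "nat^'n"
    define k where "k = real (mdeg \<alpha>) * (real (mdeg \<alpha>) - 1)"
    have "Poly_Mapping.lookup (\<Sum>t\<in>{..<N}\<times>{..<N}. q w t * q w t) \<alpha>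
        = 1 / k * Poly_Mapping.lookup (r w * r w) \<alpha>" if "w \<in> set ws" for w
      unfolding qq sq[OF that] lookup_sum sum_distrib_left
      by (intro sum.cong refl) (auto simp: lookup_single when_def k_def)
    then have "Poly_Mapping.lookup (\<Sum>w\<leftarrow>us. \<Sum>t\<in>{..<N}\<times>{..<N}. q w t * q w t) \<alpha>
        = 1 / k * Poly_Mapping.lookup (\<Sum>w\<leftarrow>us. r w * r w) \<alpha>" if "set us \<subseteq> set ws" for us
      using that by (induction us) (simp_all add: lookup_add distrib_left)
    from this[of ws] have *: "Poly_Mapping.lookup (\<Sum>w\<leftarrow>ws. \<Sum>t\<in>{..<N}\<times>{..<N}. q w t * q w t) \<alpha>
        = 1 / k * (k * Poly_Mapping.lookup f \<alpha>)"
      unfolding E[symmetric] lookup_euler_hessian k_def by simp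
    show "Poly_Mapping.lookup f \<alpha> = Poly_Mapping.lookup (\<Sum>w\<leftarrow>ws. \<Sum>t\<in>{..<N}\<times>{..<N}. q w t * q w t) \<alpha>"
    proof (cases "k = 0")
      case True
      then have "mdeg \<alpha> = 0 \<or> mdeg \<alpha> = 1" by (auto simp: k_def)
      then have "Poly_Mapping.lookup f \<alpha> = 0" using f0 f1 mdeg_zero_iff mdeg_one_cases by metis
      then show ?thesis using * by simp
    qed (use * in simp)
  qed
  also have "sum_of_squares \<dots>"
    by (intro sum_of_squares_sum_list sum_of_squares_sum sum_of_squares_square)
  finally show ?thesis .
qed

text \<open>
  Translation moves the point \<open>u\<close> to the origin and back, and preserves both sos-convexity and sums
  of squares.
\<close>

lemma sos_convex_sum_of_squares:
  assumes "sos_convex f" and f0: "eval_mpoly f u = 0"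
    and f1: "\<And>i. eval_mpoly (partial_deriv i f) u = 0"
  shows "sum_of_squares f"
proof -
  have "Poly_Mapping.lookup (translate u f) 0 = 0"
    using f0 by (simp add: eval_translate flip: eval_mpoly_at_0)
  moreover have "Poly_Mapping.lookup (translate u f) (axis i 1) = 0" for i
    using f1[of i] lookup_partial_deriv[of i "translate u f" 0]
    by (simp add: partial_deriv_translate eval_translate flip: eval_mpoly_at_0)
  ultimately have "sum_of_squares (translate u f)"
    by (intro sos_convex_sum_of_squares_at_0 sos_convex_translate assms)
  from sum_of_squares_translate[OF this, of "- u"] show ?thesis by simp
qed

text \<open>
  The difference of \<open>f\<close> and its tangent at \<open>u\<close> has the same Hessian as \<open>f\<close> and vanishes to second order
  at \<open>u\<close>; hence it is a sum of squares. Convexity of the function follows without further calculus.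
\<close>

lemma sos_convex_tangent:
  assumes "sos_convex f"
  shows "eval_mpoly f u + gradient f u \<bullet> (x - u) \<le> eval_mpoly f x"
proof -
  define h where "h = f - (Const (eval_mpoly f u)
     + (\<Sum>i\<in>UNIV. Const (gradient f u $ i) * (Var i - Const (u $ i))))"
  have d: "partial_deriv j (Const (c i) * (Var i - Const (b i)))
       = Const (if j = i then c i else 0)" for i j and b c :: "'a \<Rightarrow> real"
    by (simp add: right_diff_distrib del: partial_deriv_single single_mult_Const)
  have s: "(\<Sum>i\<in>UNIV. Const (if j = i then c i else 0)) = Const (c j)" for j and c :: "'a \<Rightarrow> real"
    by (simp add: if_distrib[of Const] cong: if_cong)
  have h1: "partial_deriv j h = partial_deriv j f - Const (gradient f u $ j)" for j
    by (simp only: h_def partial_deriv_diff partial_deriv_add partial_deriv_sum d s partial_deriv_Const add_0)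
  have "sum_of_squares h"
  proof (rule sos_convex_sum_of_squares)
    show "sos_convex h"
      using assms by (simp add: sos_convex_def h1)
    show "eval_mpoly h u = 0" by (simp add: h_def)
    show "eval_mpoly (partial_deriv i h) u = 0" for i
      by (simp add: h1 gradient_def)
  qed
  from sum_of_squares_nonneg[OF this, of x] show ?thesis
    by (simp add: h_def inner_vec_def)
qed

lemma sos_convex_convex_on:
  assumes "sos_convex f" shows "convex_on UNIV (eval_mpoly f)"
proof (rule convex_onI)
  fix t :: real and x y :: "real^'a"
  assume t: "0 < t" "t < 1"
  define z where "z = (1 - t) *\<^sub>R x + t *\<^sub>R y"
  \<comment> \<open>The convex combination of the two tangent inequalities at \<open>z\<close>: their linear parts cancel.\<close>
  have "(1 - t) * (eval_mpoly f z + gradient f z \<bullet> (x - z)) + t * (eval_mpoly f z + gradient f z \<bullet> (y - z))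
     \<le> (1 - t) * eval_mpoly f x + t * eval_mpoly f y"
    using t by (intro add_mono mult_left_mono sos_convex_tangent assms) auto
  moreover have "(1 - t) * (eval_mpoly f z + gradient f z \<bullet> (x - z)) + t * (eval_mpoly f z + gradient f z \<bullet> (y - z))
     = eval_mpoly f z"
    by (simp add: z_def inner_diff_right inner_add_right algebra_simps)
  ultimately show "eval_mpoly f ((1 - t) *\<^sub>R x + t *\<^sub>R y) \<le> (1 - t) * eval_mpoly f x + t * eval_mpoly f y"
    by (simp add: z_def)
qed simp

section \<open>The Newton polytope of a sum of squares\<close>

lemma real_exponent_add [simp]: "real_exponent (\<alpha> + \<beta>) = real_exponent \<alpha> + real_exponent \<beta>"
  by (simp add: real_exponent_def vec_eq_iff)

lemma real_exponent_eq_iff [simp]: "real_exponent \<alpha> = real_exponent \<beta> \<longleftrightarrow> \<alpha> = \<beta>"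
  by (simp add: real_exponent_def vec_eq_iff)

text \<open>
  Let \<open>C\<close> be the polytope spanned by all exponents occurring in the \<open>q\<close>. If \<open>\<alpha>\<close> is a vertex of \<open>C\<close>, the only
  way to write \<open>2\<alpha>\<close> as a sum of two of these exponents is \<open>\<alpha> + \<alpha>\<close>; so the coefficient of the sum of
  squares at \<open>2\<alpha>\<close> is the sum of the squares of the coefficients at \<open>\<alpha>\<close>, which is positive. Thus every vertex of
  \<open>C\<close> is half an exponent of the sum, and \<open>C\<close> is spanned by its vertices.
\<close>

lemma newton_polytope_sum_of_squares:
  fixes qs :: "'n::finite mpoly list"
  assumes "q \<in> set qs" "\<beta> \<in> Poly_Mapping.keys q"
  shows "real_exponent \<beta> \<in> convex hull
    ((\<lambda>v. (1/2) *\<^sub>R v) ` real_exponent ` Poly_Mapping.keys (\<Sum>q\<leftarrow>qs. q * q))"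
proof -
  define P where "P = (\<Union>q\<in>set qs. Poly_Mapping.keys q)"
  define C where "C = convex hull (real_exponent ` P)"
  have finP: "finite P" by (simp add: P_def)
  have "x \<in> (\<lambda>v. (1/2) *\<^sub>R v) ` real_exponent ` Poly_Mapping.keys (\<Sum>q\<leftarrow>qs. q * q)"
    if x: "x extreme_point_of C" for x
  proof -
    obtain \<alpha> where \<alpha>: "\<alpha> \<in> P" "x = real_exponent \<alpha>"
      using extreme_point_of_convex_hull x unfolding C_def by blast
    have uniq: "\<gamma> = \<alpha> \<and> \<delta> = \<alpha>" if "\<gamma> \<in> P" "\<delta> \<in> P" "\<gamma> + \<delta> = \<alpha> + \<alpha>" for \<gamma> \<delta>
    proof (rule ccontr)
      assume neg: "\<not> (\<gamma> = \<alpha> \<and> \<delta> = \<alpha>)"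
      have "\<gamma> \<noteq> \<delta>"
      proof
        assume "\<gamma> = \<delta>"
        then have "\<gamma> $ i = \<alpha> $ i" for i
          using arg_cong[OF that(3), of "\<lambda>v. v $ i"] by simp
        then show False using neg \<open>\<gamma> = \<delta>\<close> by (simp add: vec_eq_iff)
      qed
      moreover have "real_exponent \<gamma> + real_exponent \<delta> = x + x"
        using arg_cong[OF that(3), of real_exponent] \<alpha> by simp
      then have "x = midpoint (real_exponent \<gamma>) (real_exponent \<delta>)"
        by (simp add: midpoint_def flip: scaleR_2)
      ultimately have "x \<in> open_segment (real_exponent \<gamma>) (real_exponent \<delta>)" by simp
      moreover have "real_exponent \<gamma> \<in> C" "real_exponent \<delta> \<in> C"
        using that by (auto simp: C_def intro: hull_inc)
      ultimately show False using x by (auto simp: extreme_point_of_def)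
    qed
    have sq: "Poly_Mapping.lookup (q * q) (\<alpha> + \<alpha>) = Poly_Mapping.lookup q \<alpha> ^ 2" if "q \<in> set qs" for q
    proof -
      have "Poly_Mapping.lookup (q * q) (\<alpha> + \<alpha>) = (\<Sum>\<gamma>\<in>P. \<Sum>\<delta>\<in>P.
          if \<gamma> + \<delta> = \<alpha> + \<alpha> then Poly_Mapping.lookup q \<gamma> * Poly_Mapping.lookup q \<delta> else 0)"
        using that by (subst square_expansion[OF finP])
          (auto simp: P_def lookup_sum lookup_single when_def)
      also have "\<dots> = (\<Sum>\<gamma>\<in>P. \<Sum>\<delta>\<in>P. if \<delta> = \<alpha> then
          if \<gamma> = \<alpha> then Poly_Mapping.lookup q \<alpha> * Poly_Mapping.lookup q \<alpha> else 0 else 0)"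
      proof (intro sum.cong refl)
        fix \<gamma> \<delta> assume "\<gamma> \<in> P" "\<delta> \<in> P"
        from uniq[OF this] show "(if \<gamma> + \<delta> = \<alpha> + \<alpha> then Poly_Mapping.lookup q \<gamma> * Poly_Mapping.lookup q \<delta> else 0)
          = (if \<delta> = \<alpha> then if \<gamma> = \<alpha> then Poly_Mapping.lookup q \<alpha> * Poly_Mapping.lookup q \<alpha> else 0 else 0)"
          by (cases "\<gamma> = \<alpha> \<and> \<delta> = \<alpha>") auto
      qed
      also have "\<dots> = Poly_Mapping.lookup q \<alpha> ^ 2"
        using \<alpha>(1) finP by (simp add: sum.delta power2_eq_square)
      finally show ?thesis .
    qed
    have "Poly_Mapping.lookup (\<Sum>q\<leftarrow>us. q * q) (\<alpha> + \<alpha>) = (\<Sum>q\<leftarrow>us. Poly_Mapping.lookup q \<alpha> ^ 2)"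
      if "set us \<subseteq> set qs" for us
      using that by (induction us) (simp_all add: lookup_add sq)
    then have eq: "Poly_Mapping.lookup (\<Sum>q\<leftarrow>qs. q * q) (\<alpha> + \<alpha>) = (\<Sum>q\<leftarrow>qs. Poly_Mapping.lookup q \<alpha> ^ 2)"
      by blast
    obtain p where p: "p \<in> set qs" "Poly_Mapping.lookup p \<alpha> \<noteq> 0"
      using \<alpha>(1) by (auto simp: P_def in_keys_iff)
    have "Poly_Mapping.lookup p \<alpha> ^ 2 \<le> (\<Sum>q\<leftarrow>qs. Poly_Mapping.lookup q \<alpha> ^ 2)"
      using p(1) by (intro member_le_sum_list) auto
    then have "Poly_Mapping.lookup (\<Sum>q\<leftarrow>qs. q * q) (\<alpha> + \<alpha>) \<noteq> 0"
      unfolding eq using p(2) by (smt (verit) zero_less_power2)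
    then have "\<alpha> + \<alpha> \<in> Poly_Mapping.keys (\<Sum>q\<leftarrow>qs. q * q)" by (simp add: in_keys_iff)
    moreover have "x = (1/2) *\<^sub>R real_exponent (\<alpha> + \<alpha>)" by (simp add: \<alpha> flip: scaleR_2)
    ultimately show ?thesis by blast
  qed
  then have "convex hull {x. x extreme_point_of C} \<subseteq> convex hull
      ((\<lambda>v. (1/2) *\<^sub>R v) ` real_exponent ` Poly_Mapping.keys (\<Sum>q\<leftarrow>qs. q * q))"
    by (intro hull_mono) auto
  moreover have "C = convex hull {x. x extreme_point_of C}"
    unfolding C_def by (intro Krein_Milman_Minkowski finite_imp_compact_convex_hull finite_imageI finP convex_convex_hull)
  moreover have "real_exponent \<beta> \<in> C"
    unfolding C_def using assms by (intro hull_inc) (auto simp: P_def)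
  ultimately show ?thesis by blast
qed

section \<open>Lagrange multipliers for sos-concave constraints\<close>

lemma sos_concave_tangent:
  assumes "sos_concave f"
  shows "eval_mpoly f x \<le> eval_mpoly f u + gradient f u \<bullet> (x - u)"
proof -
  have "gradient (- f) u = - gradient f u" by (simp add: gradient_def vec_eq_iff)
  then show ?thesis using sos_convex_tangent[of "- f" u x] assms by (simp add: sos_concave_def)
qed

lemma sos_concave_concave_on:
  assumes "sos_concave f" "0 \<le> t" "t \<le> 1"
  shows "(1 - t) * eval_mpoly f x + t * eval_mpoly f y \<le> eval_mpoly f ((1 - t) *\<^sub>R x + t *\<^sub>R y)"
  using convex_onD[OF sos_convex_convex_on[of "- f"], of t x y] assms by (simp add: sos_concave_def)

lemma closed_feasible_set: "closed (feasible_set g)"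
  unfolding feasible_set_def
  by (intro closed_Collect_all closed_Collect_le continuous_eval_mpoly continuous_intros)

lemma convex_feasible_set:
  assumes "\<forall>k. sos_concave (g k)" shows "convex (feasible_set g)"
proof (rule convexI)
  fix x y and s t :: real
  assume xy: "x \<in> feasible_set g" "y \<in> feasible_set g" and st: "0 \<le> s" "0 \<le> t" "s + t = 1"
  have "0 \<le> eval_mpoly (g k) (s *\<^sub>R x + t *\<^sub>R y)" for k
  proof -
    have s: "s = 1 - t" using st by simp
    have "0 \<le> (1 - t) * eval_mpoly (g k) x + t * eval_mpoly (g k) y"
      using xy st by (simp add: feasible_set_def s)
    also have "\<dots> \<le> eval_mpoly (g k) (s *\<^sub>R x + t *\<^sub>R y)"
      unfolding s using assms st by (intro sos_concave_concave_on) auto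
    finally show ?thesis .
  qed
  then show "s *\<^sub>R x + t *\<^sub>R y \<in> feasible_set g" by (simp add: feasible_set_def)
qed

text \<open>
  A concave function that is nonnegative near one of its zeros vanishes near it. On every line through
  that zero the polynomial therefore has infinitely many roots.
\<close>

lemma sos_concave_zero_interior:
  assumes "sos_concave f" "0 < e" and nonneg: "\<And>y. dist y p < e \<Longrightarrow> 0 \<le> eval_mpoly f y"
    and "eval_mpoly f p = 0"
  shows "eval_mpoly f x = 0"
proof -
  define v where "v = x - p"
  obtain q where q: "\<And>t. eval_mpoly f (p + t *\<^sub>R v) = poly q t"
    using eval_mpoly_line_poly by blast
  define \<delta> where "\<delta> = e / (norm v + 1)"
  have "0 < \<delta>" using assms(2) by (simp add: \<delta>_def add_nonneg_pos)
  have "poly q t = 0" if t: "\<bar>t\<bar> < \<delta>" for t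
  proof -
    have n: "\<bar>t\<bar> * norm v < e"
    proof -
      have "\<bar>t\<bar> * norm v \<le> \<bar>t\<bar> * (norm v + 1)" by (simp add: mult_left_mono)
      also have "\<dots> < \<delta> * (norm v + 1)" using t by (intro mult_strict_right_mono) (auto simp: add_nonneg_pos)
      also have "\<dots> = e" by (simp add: \<delta>_def add_nonneg_eq_0_iff)
      finally show ?thesis .
    qed
    have "0 \<le> poly q t" "0 \<le> poly q (- t)"
      using n by (auto simp: dist_norm intro!: nonneg simp flip: q)
    moreover have "poly q s \<le> s * (gradient f p \<bullet> v)" for s
      using sos_concave_tangent[OF assms(1), of "p + s *\<^sub>R v" p] assms(4) by (simp add: q)
    from this[of t] this[of "- t"] have "poly q t + poly q (- t) \<le> 0" by simp
    ultimately show ?thesis by linarith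
  qed
  then have "{-\<delta><..<\<delta>} \<subseteq> {t. poly q t = 0}" by auto
  moreover have "infinite {-\<delta><..<\<delta>}" using \<open>0 < \<delta>\<close> by (simp add: infinite_Ioo)
  ultimately have "q = 0" using poly_roots_finite finite_subset by blast
  then show ?thesis using q[of 1] by (simp add: v_def)
qed

text \<open>
  The left-hand side of the decomposition assumption.
\<close>

definition lagrangian :: "('m::finite \<Rightarrow> 'n::finite mpoly) \<Rightarrow> real^'n \<Rightarrow> real \<Rightarrow> real^'m \<Rightarrow> 'n mpoly" where
  "lagrangian g a b lam =
     (\<Sum>j\<in>UNIV. Const (a $ j) * Var j) - Const b - (\<Sum>k\<in>UNIV. Const (lam $ k) * g k)"

lemma eval_lagrangian:
  "eval_mpoly (lagrangian g a b lam) x = a \<bullet> x - b - (\<Sum>k\<in>UNIV. lam $ k * eval_mpoly (g k) x)"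
  by (simp add: lagrangian_def inner_vec_def del: single_mult_Const)

lemma partial_deriv_lagrangian:
  fixes g :: "'m::finite \<Rightarrow> 'n::finite mpoly"
  shows "partial_deriv i (lagrangian g a b lam)
     = Const (a $ i) - (\<Sum>k\<in>UNIV. Const (lam $ k) * partial_deriv i (g k))"
proof -
  have "(\<Sum>j\<in>UNIV. Const (a $ j) * Const (if i = j then 1 else 0)) = (Const (a $ i) :: 'n mpoly)"
    by (simp add: if_distrib[of Const] if_distrib cong: if_cong)
  then show ?thesis
    by (simp only: lagrangian_def partial_deriv_diff partial_deriv_sum partial_deriv_Const_mult
        partial_deriv_Var partial_deriv_Const diff_zero)
qed

lemma sos_convex_lagrangian:
  assumes "\<forall>k. sos_concave (g k)" "\<forall>k. 0 \<le> lam $ k"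
  shows "sos_convex (lagrangian g a b lam)"
proof -
  have "sos_convex ((\<Sum>j\<in>UNIV. Const (a $ j) * Var j) - Const b)"
    by (rule sos_convex_affine)
       (simp only: partial_deriv_diff partial_deriv_sum partial_deriv_Const_mult
        partial_deriv_Var partial_deriv_Const mult_zero_right sum.neutral_const diff_zero)
  moreover have "sos_convex (\<Sum>k\<in>UNIV. Const (lam $ k) * (- g k))"
    using assms by (intro sos_convex_sum sos_convex_scale) (auto simp: sos_concave_def)
  ultimately show ?thesis
    using sos_convex_add unfolding lagrangian_def
    by (fastforce simp: sum_negf)
qed

lemma nonneg_slope:
  fixes c s :: real assumes "\<And>t. 0 \<le> t \<Longrightarrow> 0 \<le> c + s * t" shows "0 \<le> s"
proof (rule ccontr)
  assume "\<not> 0 \<le> s"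
  then have "c + s * ((\<bar>c\<bar> + 1) / (- s)) < 0" "0 \<le> (\<bar>c\<bar> + 1) / (- s)"
    by (auto simp: divide_simps)
  then show False using assms by fastforce
qed

text \<open>
  The usual duality argument: the set \<open>C\<close> of all pairs (value, constraints) that can be attained or
  worsened is convex and misses the origin, and a separating hyperplane is a vector of
  multipliers. That the objective receives a nonzero weight \<open>\<rho>\<close> is Slater's condition, which holds at the
  interior point \<open>p\<close> for every constraint in \<open>N\<close>. The other constraints are identically
  zero by \<open>sos_concave_zero_interior\<close>; \<open>C\<close> leaves their coordinates free, which forces their
  multipliers to be zero. Stationarity holds because the Lagrangian is nonnegative everywhere and vanishes at \<open>u\<close>.
\<close>

lemma lagrange_multipliers:
  fixes g :: "'m::finite \<Rightarrow> 'n::finite mpoly"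
  assumes conc: "\<forall>k. sos_concave (g k)" and int: "p \<in> interior (feasible_set g)"
    and u: "u \<in> feasible_set g" and min: "\<And>x. x \<in> feasible_set g \<Longrightarrow> a \<bullet> u \<le> a \<bullet> x"
  obtains lam :: "real^'m" where "\<forall>k. 0 \<le> lam $ k" "\<forall>k. lam $ k * eval_mpoly (g k) u = 0"
    "a = (\<Sum>k\<in>UNIV. lam $ k *\<^sub>R gradient (g k) u)"
proof -
  define G where "G k = eval_mpoly (g k)" for k
  define N where "N = {k. 0 < G k p}"
  define C where "C = {(r :: real, s :: real^'m). \<exists>x. a \<bullet> x - a \<bullet> u < r \<and> (\<forall>k\<in>N. s $ k \<le> G k x)}"
  obtain e where e: "0 < e" "ball p e \<subseteq> feasible_set g" using int by (auto simp: mem_interior)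
  have zero: "G k x = 0" if "k \<notin> N" for k x
    unfolding G_def
  proof (rule sos_concave_zero_interior[of _ e p])
    show "0 \<le> eval_mpoly (g k) y" if "dist y p < e" for y
      using that e(2) by (auto simp: feasible_set_def dist_commute subset_iff)
    from this[of p] show "eval_mpoly (g k) p = 0" using that e(1) by (auto simp: N_def G_def)
  qed (use conc e in auto)
  have "convex C"
  proof (rule convexI)
    fix z z' and s t :: real assume z: "z \<in> C" "z' \<in> C" and st: "0 \<le> s" "0 \<le> t" "s + t = 1"
    obtain x x' where x: "a \<bullet> x - a \<bullet> u < fst z" "\<forall>k\<in>N. snd z $ k \<le> G k x"
      and x': "a \<bullet> x' - a \<bullet> u < fst z'" "\<forall>k\<in>N. snd z' $ k \<le> G k x'"
      using z by (auto simp: C_def)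
    have s: "s = 1 - t" using st by simp
    let ?x = "s *\<^sub>R x + t *\<^sub>R x'"
    have "s * (a \<bullet> x - a \<bullet> u) + t * (a \<bullet> x' - a \<bullet> u) < s * fst z + t * fst z'"
    proof (cases "t = 0")
      case False
      then show ?thesis using st x(1) x'(1) by (intro add_le_less_mono mult_left_mono mult_strict_left_mono) auto
    qed (use s x in simp)
    then have "a \<bullet> ?x - a \<bullet> u < fst (s *\<^sub>R z + t *\<^sub>R z')"
      by (simp add: s inner_add_right algebra_simps)
    moreover have "snd (s *\<^sub>R z + t *\<^sub>R z') $ k \<le> G k ?x" if "k \<in> N" for k
    proof -
      have "snd (s *\<^sub>R z + t *\<^sub>R z') $ k \<le> s * G k x + t * G k x'"
        using x(2) x'(2) that st by (auto intro!: add_mono mult_left_mono)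
      also have "\<dots> \<le> G k ?x"
        unfolding s G_def using conc st by (intro sos_concave_concave_on) auto
      finally show ?thesis .
    qed
    ultimately show "s *\<^sub>R z + t *\<^sub>R z' \<in> C" unfolding C_def by (auto simp: case_prod_unfold)
  qed
  moreover have "0 \<notin> C"
  proof
    assume "0 \<in> C"
    then obtain x where x: "a \<bullet> x < a \<bullet> u" "\<forall>k\<in>N. 0 \<le> G k x" by (auto simp: C_def zero_prod_def)
    then have "\<forall>k. 0 \<le> G k x" using zero by (metis order_refl)
    then show False using min[of x] x(1) by (simp add: feasible_set_def G_def)
  qed
  ultimately obtain h where h: "h \<noteq> 0" "\<forall>z\<in>C. 0 \<le> h \<bullet> z"
    using separating_hyperplane_set_0 by blast
  obtain \<rho> \<mu> where h_eq: "h = (\<rho>, \<mu>)" by (cases h)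
  have sep: "0 \<le> \<rho> * r + \<mu> \<bullet> s" if "a \<bullet> x - a \<bullet> u < r" "\<forall>k\<in>N. s $ k \<le> G k x" for r s x
    using h(2) that unfolding C_def h_eq by force
  \<comment> \<open>A base point in \<open>C\<close>. From it \<open>C\<close> contains a ray in every direction that makes a pair worse,
    and in both directions for the constraints outside \<open>N\<close>, which determines the signs.\<close>
  define r0 where "r0 = a \<bullet> p - a \<bullet> u + 1"
  define s0 where "s0 = (\<chi> k. G k p)"
  have "0 \<le> \<rho>"
  proof (rule nonneg_slope)
    show "0 \<le> (\<rho> * r0 + \<mu> \<bullet> s0) + \<rho> * t" if "0 \<le> t" for t
      using sep[of p "r0 + t" s0] that by (simp add: r0_def s0_def algebra_simps)
  qed
  have "\<mu> $ k \<le> 0" for k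
  proof -
    have "0 \<le> - \<mu> $ k"
    proof (rule nonneg_slope)
      show "0 \<le> (\<rho> * r0 + \<mu> \<bullet> s0) + (- \<mu> $ k) * t" if "0 \<le> t" for t
      proof -
        have "\<forall>l\<in>N. (s0 - axis k t) $ l \<le> G l p" using that by (simp add: s0_def axis_def)
        then show ?thesis
          using sep[of p r0 "s0 - axis k t"] by (simp add: r0_def inner_diff_right inner_axis)
      qed
    qed
    then show ?thesis by simp
  qed
  have \<mu>0: "\<mu> $ k = 0" if "k \<notin> N" for k
  proof -
    have "0 \<le> \<mu> $ k"
    proof (rule nonneg_slope)
      show "0 \<le> (\<rho> * r0 + \<mu> \<bullet> s0) + \<mu> $ k * t" for t
      proof -
        have "\<forall>l\<in>N. (s0 + axis k t) $ l \<le> G l p" using that by (auto simp: s0_def axis_def)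
        then show ?thesis
          using sep[of p r0 "s0 + axis k t"] by (simp add: r0_def inner_add_right inner_axis)
      qed
    qed
    then show ?thesis using \<open>\<mu> $ k \<le> 0\<close> by simp
  qed
  have lag: "0 \<le> \<rho> * (a \<bullet> x - a \<bullet> u) + (\<Sum>k\<in>UNIV. \<mu> $ k * G k x)" for x
  proof (rule field_le_epsilon)
    fix \<epsilon> :: real assume "0 < \<epsilon>"
    define \<eta> where "\<eta> = \<epsilon> / (\<rho> + 1)"
    have "0 < \<eta>" "\<rho> * \<eta> \<le> \<epsilon>" using \<open>0 < \<epsilon>\<close> \<open>0 \<le> \<rho>\<close> by (auto simp: \<eta>_def divide_simps)
    have "0 \<le> \<rho> * (a \<bullet> x - a \<bullet> u + \<eta>) + \<mu> \<bullet> (\<chi> k. G k x)"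
      using \<open>0 < \<eta>\<close> by (intro sep[of x]) auto
    also have "\<dots> \<le> \<rho> * (a \<bullet> x - a \<bullet> u) + (\<Sum>k\<in>UNIV. \<mu> $ k * G k x) + \<epsilon>"
      using \<open>\<rho> * \<eta> \<le> \<epsilon>\<close> by (simp add: inner_vec_def algebra_simps)
    finally show "0 \<le> \<rho> * (a \<bullet> x - a \<bullet> u) + (\<Sum>k\<in>UNIV. \<mu> $ k * G k x) + \<epsilon>" .
  qed
  have "\<rho> \<noteq> 0"
  proof
    assume "\<rho> = 0"
    have nonpos: "\<mu> $ k * G k p \<le> 0" for k
      using \<open>\<mu> $ k \<le> 0\<close> zero[of k p] by (cases "k \<in> N") (auto simp: N_def mult_nonpos_nonneg)
    have "\<mu> $ k = 0" for k
    proof (cases "k \<in> N")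
      case True
      have "(\<Sum>k\<in>UNIV. - (\<mu> $ k * G k p)) = 0"
        using lag[of p] \<open>\<rho> = 0\<close> nonpos by (intro antisym sum_nonneg) (auto simp: sum_negf)
      then have "\<mu> $ k * G k p = 0"
        using nonpos by (subst (asm) sum_nonneg_eq_0_iff) auto
      then show ?thesis using True by (simp add: N_def)
    qed (rule \<mu>0)
    then show False using h(1) \<open>\<rho> = 0\<close> by (simp add: h_eq vec_eq_iff zero_prod_def)
  qed
  then have "0 < \<rho>" using \<open>0 \<le> \<rho>\<close> by simp
  define lam where "lam = (\<chi> k. - \<mu> $ k / \<rho>)"
  define F where "F = lagrangian g a (a \<bullet> u) lam"
  have lam: "0 \<le> lam $ k" for k
    using \<open>\<mu> $ k \<le> 0\<close> \<open>0 < \<rho>\<close> by (simp add: lam_def divide_nonpos_pos)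
  have F: "0 \<le> eval_mpoly F x" for x
  proof -
    have "eval_mpoly F x = (\<rho> * (a \<bullet> x - a \<bullet> u) + (\<Sum>k\<in>UNIV. \<mu> $ k * G k x)) / \<rho>"
      using \<open>0 < \<rho>\<close> by (simp add: F_def eval_lagrangian lam_def G_def sum_negf add_divide_distrib
          flip: sum_divide_distrib)
    then show ?thesis using lag[of x] \<open>0 < \<rho>\<close> by simp
  qed
  have Gu: "0 \<le> eval_mpoly (g k) u" for k using u by (simp add: feasible_set_def)
  have "(\<Sum>k\<in>UNIV. lam $ k * eval_mpoly (g k) u) = 0"
    using F[of u] lam Gu by (intro antisym sum_nonneg) (auto simp: F_def eval_lagrangian)
  then have compl: "lam $ k * eval_mpoly (g k) u = 0" for k
    using lam Gu by (subst (asm) sum_nonneg_eq_0_iff) auto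
  have Fu: "eval_mpoly F u = 0" by (simp add: F_def eval_lagrangian compl)
  have "eval_mpoly (partial_deriv i F) u = 0" for i
  proof -
    have "((\<lambda>t. eval_mpoly F (u + t *\<^sub>R axis i 1)) has_real_derivative eval_mpoly (partial_deriv i F) u) (at 0)"
      using eval_mpoly_has_derivative_line[of F u "axis i 1" 0]
      by (simp add: axis_def if_distrib[of "\<lambda>x. x * _"] cong: if_cong)
    then show ?thesis
      by (rule DERIV_local_min[of _ _ _ 1]) (use F Fu in auto)
  qed
  then have "a = (\<Sum>k\<in>UNIV. lam $ k *\<^sub>R gradient (g k) u)"
    by (simp add: F_def partial_deriv_lagrangian vec_eq_iff gradient_def)
  then show thesis using lam compl that by blast
qed

section \<open>The linearization functional\<close>

lemma linearize_add: "linearize d J (p + q) x y = linearize d J p x y + linearize d J q x y"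
  by (simp add: linearize_def lookup_add distrib_left sum.distrib)

lemma linearize_zero [simp]: "linearize d J 0 x y = 0"
  by (simp add: linearize_def)

lemma linearize_Const_mult: "linearize d J (Const c * p) x y = c * linearize d J p x y"
  by (simp add: linearize_def, simp add: distrib_left sum_distrib_left mult_ac)

lemma linearize_diff: "linearize d J (p - q) x y = linearize d J p x y - linearize d J q x y"
  by (simp add: linearize_def lookup_minus right_diff_distrib sum_subtractf)

lemma linearize_sum: "linearize d J (\<Sum>i\<in>A. f i) x y = (\<Sum>i\<in>A. linearize d J (f i) x y)"
  by (induction A rule: infinite_finite_induct) (auto simp: linearize_add)

lemma linearize_Const [simp]: "linearize d J (Const c) x y = c"
proof -
  have "Poly_Mapping.lookup (Const c) \<alpha> = (if \<alpha> = 0 then c else 0)" for \<alpha> :: "nat^'a"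
    by (simp add: lookup_single when_def)
  then show ?thesis by (auto simp: linearize_def intro!: sum.neutral)
qed

lemma linearize_Var [simp]: "linearize d UNIV (Var j) x y = x $ j"
proof -
  have "(\<Sum>i\<in>UNIV. x $ i * Poly_Mapping.lookup (Var j) (axis i 1)) = (\<Sum>i\<in>UNIV. if i = j then x $ i else 0)"
    by (rule sum.cong) (auto simp: lookup_single when_def axis_eq_axis)
  moreover have "(\<Sum>\<alpha> | 1 < mdeg \<alpha> \<and> mdeg \<alpha> \<le> 2 * d. y \<alpha> * Poly_Mapping.lookup (Var j) \<alpha>) = 0"
    by (rule sum.neutral) (auto simp: lookup_single when_def)
  ultimately show ?thesis by (simp add: linearize_def lookup_single when_def)
qed

lemma linearize_only_variables:
  assumes "only_variables J p" shows "linearize d J p x y = linearize d UNIV p x y"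
proof -
  have "(\<Sum>j\<in>J. x $ j * Poly_Mapping.lookup p (axis j 1)) = (\<Sum>j\<in>UNIV. x $ j * Poly_Mapping.lookup p (axis j 1))"
  proof (rule sum.mono_neutral_left)
    show "\<forall>j\<in>UNIV - J. x $ j * Poly_Mapping.lookup p (axis j 1) = 0"
      using assms unfolding only_variables_def
      by (metis DiffD2 axis_nth mult_zero_right not_in_keys_iff_lookup_eq_zero one_neq_zero)
  qed auto
  then show ?thesis by (simp add: linearize_def)
qed

lemma linearize_moments_single:
  assumes "mdeg \<alpha> \<le> 2 * d"
  shows "linearize d UNIV (Poly_Mapping.single \<alpha> c) x (eval_mon x) = c * eval_mon x \<alpha>"
proof -
  have "linearize d UNIV (Mon \<alpha>) x (eval_mon x) = eval_mon x \<alpha>"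
  proof -
    consider "mdeg \<alpha> = 0" | "mdeg \<alpha> = 1" | "1 < mdeg \<alpha>" by linarith
    then show ?thesis
    proof cases
      case 1
      then have "\<alpha> = 0" by (simp add: mdeg_zero_iff)
      then show ?thesis using linearize_Const[of d UNIV 1 x "eval_mon x"] by (simp add: eval_mon_def)
    next
      case 2
      then obtain j where \<alpha>: "\<alpha> = axis j 1" by (rule mdeg_one_cases)
      have "eval_mpoly (Var j) x = eval_mon x (axis j 1)" by (simp add: eval_mpoly_def del: eval_Var)
      then show ?thesis by (simp add: \<alpha>)
    next
      case 3
      have "Poly_Mapping.lookup (Mon \<alpha>) \<beta> = (if \<beta> = \<alpha> then 1 else (0::real))" for \<beta>
        by (simp add: lookup_single when_def)
      moreover have "axis j 1 \<noteq> \<alpha>" "\<alpha> \<noteq> 0" for j using 3 by auto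
      moreover have "finite {\<beta> :: nat^'a. 1 < mdeg \<beta> \<and> mdeg \<beta> \<le> 2 * d}"
        by (rule finite_subset[OF _ finite_mdeg_le[of "2 * d"]]) auto
      ultimately show ?thesis
        using 3 assms by (simp add: linearize_def if_distrib[of "\<lambda>x. _ * x"] cong: if_cong)
    qed
  qed
  then show ?thesis using linearize_Const_mult[of d UNIV c "Mon \<alpha>"] by simp
qed

text \<open>
  Choosing for \<open>y\<close> the actual values of the monomials recovers evaluation at \<open>x\<close>.
\<close>

lemma linearize_moments:
  assumes "\<And>\<alpha>. \<alpha> \<in> Poly_Mapping.keys p \<Longrightarrow> mdeg \<alpha> \<le> 2 * d"
  shows "linearize d UNIV p x (eval_mon x) = eval_mpoly p x"
  unfolding eval_mpoly_def
  by (subst mpoly_sum_monomials, subst linearize_sum, rule sum.cong[OF refl])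
     (simp add: linearize_moments_single assms)

lemma eval_Mon: "eval_mpoly (Mon \<alpha>) x = eval_mon x \<alpha>"
  by (simp add: eval_mpoly_def)

text \<open>
  The value on \<open>q\<^sup>2\<close> is the quadratic form of the moment matrix at the coefficient vector of \<open>q\<close>. This
  is where the location of the exponents of \<open>q\<close> matters.
\<close>

lemma linearize_square_nonneg:
  assumes psd: "psd_on F (\<lambda>\<beta> \<gamma>. linearize d UNIV (Mon \<beta> * Mon \<gamma>) x y)"
    and keys: "Poly_Mapping.keys q \<subseteq> F"
  shows "0 \<le> linearize d UNIV (q * q) x y"
proof -
  let ?c = "Poly_Mapping.lookup q"
  have "finite F" using psd by (simp add: psd_on_def)
  have "Poly_Mapping.single (\<beta> + \<gamma>) (?c \<beta> * ?c \<gamma>) = Const (?c \<beta> * ?c \<gamma>) * (Mon \<beta> * Mon \<gamma>)" for \<beta> \<gamma>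
    by (simp add: mult_single)
  then have "linearize d UNIV (q * q) x y
      = (\<Sum>\<beta>\<in>F. \<Sum>\<gamma>\<in>F. ?c \<beta> * linearize d UNIV (Mon \<beta> * Mon \<gamma>) x y * ?c \<gamma>)"
    by (simp only: square_expansion[OF \<open>finite F\<close> keys] linearize_sum linearize_Const_mult)
       (simp add: mult_ac)
  then show ?thesis using psd by (simp add: psd_on_def)
qed

lemma mdeg_le_total_degree: "\<alpha> \<in> Poly_Mapping.keys p \<Longrightarrow> mdeg \<alpha> \<le> total_degree p"
  unfolding total_degree_def by (intro Max_ge) auto

lemma half_degree:
  fixes g :: "'m::finite \<Rightarrow> 'n::finite mpoly"
  shows "1 \<le> half_degree g" "\<alpha> \<in> Poly_Mapping.keys (g k) \<Longrightarrow> mdeg \<alpha> \<le> 2 * half_degree g"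
proof -
  let ?P = "\<lambda>d. 1 \<le> d \<and> (\<forall>k. total_degree (g k) \<le> 2 * d)"
  have "?P (Suc (\<Sum>k\<in>UNIV. total_degree (g k)))"
  proof (intro conjI allI)
    fix k
    have "total_degree (g k) \<le> (\<Sum>k\<in>UNIV. total_degree (g k))" by (rule member_le_sum) auto
    also have "\<dots> \<le> 2 * Suc (\<Sum>k\<in>UNIV. total_degree (g k))" by simp
    finally show "total_degree (g k) \<le> 2 * Suc (\<Sum>k\<in>UNIV. total_degree (g k))" .
  qed (simp add: One_nat_def)
  then have "?P (half_degree g)" unfolding half_degree_def by (rule LeastI)
  then show "1 \<le> half_degree g" "\<alpha> \<in> Poly_Mapping.keys (g k) \<Longrightarrow> mdeg \<alpha> \<le> 2 * half_degree g"
    using mdeg_le_total_degree le_trans by blast+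
qed

section \<open>Separable polynomials and the half exponents\<close>

lemma only_variables_partial_deriv:
  assumes "only_variables J p" shows "only_variables J (partial_deriv i p)"
  unfolding only_variables_def
proof (intro ballI allI impI)
  fix \<alpha> j assume "\<alpha> \<in> Poly_Mapping.keys (partial_deriv i p)" and j: "\<alpha> $ j \<noteq> 0"
  then have "\<alpha> + axis i 1 \<in> Poly_Mapping.keys p" by (auto simp: in_keys_iff lookup_partial_deriv)
  moreover have "(\<alpha> + axis i 1) $ j \<noteq> 0" using j by simp
  ultimately show "j \<in> J" using assms unfolding only_variables_def by blast
qed

lemma partial_deriv_only_variables:
  fixes p :: "'n::finite mpoly"
  assumes "only_variables J p" "i \<notin> J" shows "partial_deriv i p = 0"
proof (rule poly_mapping_eqI)
  fix \<alpha> :: "nat^'n"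
  have "(\<alpha> + axis i 1) $ i \<noteq> 0" by simp
  then have "\<alpha> + axis i 1 \<notin> Poly_Mapping.keys p"
    using assms unfolding only_variables_def by blast
  then show "Poly_Mapping.lookup (partial_deriv i p) \<alpha> = Poly_Mapping.lookup 0 \<alpha>"
    by (simp add: lookup_partial_deriv in_keys_iff)
qed

text \<open>
  Summands in disjoint groups of variables inherit the properties of their sum: the
  Hessian of \<open>\<psi> i\<close> is the block of the Hessian of the sum that belongs to \<open>I i\<close>, and nonconstant monomials
  of different summands cannot cancel.
\<close>

context
  fixes I :: "'k::finite \<Rightarrow> 'n::finite set" and \<psi> :: "'k \<Rightarrow> 'n mpoly"
  assumes disj: "disjoint_family I" and vars: "\<And>i. only_variables (I i) (\<psi> i)"
begin

lemma partial_deriv_separable: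
  "partial_deriv p (\<psi> i) = (if p \<in> I i then partial_deriv p (\<Sum>i\<in>UNIV. \<psi> i) else 0)"
proof (cases "p \<in> I i")
  case True
  have "partial_deriv p (\<psi> j) = 0" if "j \<noteq> i" for j
    using that True disj by (intro partial_deriv_only_variables[OF vars]) (auto simp: disjoint_family_on_def)
  then have "(\<Sum>j\<in>UNIV. partial_deriv p (\<psi> j)) = (\<Sum>j\<in>UNIV. if j = i then partial_deriv p (\<psi> i) else 0)"
    by (intro sum.cong) auto
  then show ?thesis using True by simp
qed (simp add: partial_deriv_only_variables[OF vars])

text \<open>
  Setting to zero the columns outside \<open>I i\<close> of the factor \<open>W\<close> of the Hessian leaves the block of \<open>I i\<close>.
\<close>

lemma sos_convex_separable:
  assumes "sos_convex (\<Sum>i\<in>UNIV. \<psi> i)" shows "sos_convex (\<psi> i)"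
proof -
  obtain ws where ws: "\<And>p q. partial_deriv p (partial_deriv q (\<Sum>i\<in>UNIV. \<psi> i)) = (\<Sum>w\<leftarrow>ws. w p * w q)"
    using assms by (auto simp: sos_convex_iff_list)
  have "partial_deriv p (partial_deriv q (\<psi> i))
     = (\<Sum>w\<leftarrow>map (\<lambda>w p. if p \<in> I i then w p else 0) ws. w p * w q)" for p q
  proof (cases "p \<in> I i \<and> q \<in> I i")
    case True
    then show ?thesis using ws[of p q] partial_deriv_separable[of q i] by (simp add: o_def)
  next
    case False
    then have "partial_deriv p (partial_deriv q (\<psi> i)) = 0"
      using partial_deriv_only_variables[OF only_variables_partial_deriv[OF vars], of p i]
        partial_deriv_only_variables[OF vars, of q i] by (cases "q \<in> I i") auto
    moreover have "(\<Sum>w\<leftarrow>us. (if p \<in> I i then w p else 0) * (if q \<in> I i then w q else 0)) = 0"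
      for us :: "('n \<Rightarrow> 'n mpoly) list"
      using False by (induction us) auto
    ultimately show ?thesis by (simp add: o_def)
  qed
  then show ?thesis unfolding sos_convex_iff_list by blast
qed

lemma keys_separable:
  assumes "\<alpha> \<in> Poly_Mapping.keys (\<psi> i)" "\<alpha> \<noteq> 0"
  shows "\<alpha> \<in> Poly_Mapping.keys (\<Sum>i\<in>UNIV. \<psi> i)"
proof -
  obtain p where p: "\<alpha> $ p \<noteq> 0" using assms(2) by (auto simp: vec_eq_iff)
  then have "p \<in> I i" using vars assms(1) by (auto simp: only_variables_def)
  then have "\<alpha> \<notin> Poly_Mapping.keys (\<psi> j)" if "j \<noteq> i" for j
  proof -
    have "p \<notin> I j" using that disj \<open>p \<in> I i\<close> unfolding disjoint_family_on_def by blast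
    then show ?thesis using p vars[of j] unfolding only_variables_def by blast
  qed
  then have "(\<Sum>j\<in>UNIV. Poly_Mapping.lookup (\<psi> j) \<alpha>) = (\<Sum>j\<in>UNIV. if j = i then Poly_Mapping.lookup (\<psi> i) \<alpha> else 0)"
    by (intro sum.cong) (auto simp: in_keys_iff)
  then show ?thesis using assms(1) by (simp add: in_keys_iff lookup_sum)
qed

end

lemma decompositionD:
  assumes "decomposition g I \<phi>" "(a, b, lam) \<in> supporting_triples g"
  shows "only_variables (I i) (\<phi> (a, b, lam) i)" "lagrangian g a b lam = (\<Sum>i\<in>UNIV. \<phi> (a, b, lam) i)"
  using assms unfolding decomposition_def lagrangian_def by blast+

lemma mdeg_lagrangian:
  assumes "\<alpha> \<in> Poly_Mapping.keys (lagrangian g a b lam)"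
  shows "mdeg \<alpha> \<le> 2 * half_degree g"
proof (rule ccontr)
  assume neg: "\<not> ?thesis"
  have "1 \<le> half_degree g" by (rule half_degree)
  then have "\<alpha> \<noteq> 0" "axis j 1 \<noteq> \<alpha>" for j using neg by auto
  moreover have "Poly_Mapping.lookup (g k) \<alpha> = 0" for k
    using neg half_degree(2)[of \<alpha> g k] by (auto simp: in_keys_iff)
  ultimately have "Poly_Mapping.lookup (lagrangian g a b lam) \<alpha> = 0"
    by (auto simp: lagrangian_def lookup_minus lookup_sum lookup_single when_def)
  then show False using assms by (simp add: in_keys_iff)
qed

text \<open>
  Both properties are closed under convex combinations and hold for half the exponents of the
  \<open>\<phi> t i\<close>, whose degrees are bounded by that of the Lagrangian since there is no cancellation.
\<close>

lemma half_exponents_bounds: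
  fixes g :: "'m::finite \<Rightarrow> 'n::finite mpoly"
  assumes dec: "decomposition g I \<phi>" and disj: "disjoint_family I" and \<alpha>: "\<alpha> \<in> half_exponents g \<phi> i"
  shows "mdeg \<alpha> \<le> half_degree g" "\<alpha> $ j \<noteq> 0 \<Longrightarrow> j \<in> I i"
proof -
  define B where "B = {v :: real^'n. (\<Sum>j\<in>UNIV. v $ j) \<le> real (half_degree g) \<and> (\<forall>j. j \<notin> I i \<longrightarrow> v $ j = 0)}"
  have "convex B"
  proof (rule convexI)
    fix v w :: "real^'n" and s t :: real
    assume vw: "v \<in> B" "w \<in> B" and st: "0 \<le> s" "0 \<le> t" "s + t = 1"
    have "(\<Sum>j\<in>UNIV. (s *\<^sub>R v + t *\<^sub>R w) $ j) = s * (\<Sum>j\<in>UNIV. v $ j) + t * (\<Sum>j\<in>UNIV. w $ j)"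
      by (simp add: sum.distrib sum_distrib_left)
    also have "\<dots> \<le> s * real (half_degree g) + t * real (half_degree g)"
      using vw st by (intro add_mono mult_left_mono) (auto simp: B_def)
    also have "\<dots> = real (half_degree g)" using st by (simp flip: distrib_right)
    finally show "s *\<^sub>R v + t *\<^sub>R w \<in> B" using vw by (simp add: B_def)
  qed
  moreover have "(1/2) *\<^sub>R real_exponent \<beta> \<in> B"
    if t: "t \<in> supporting_triples g" and \<beta>: "\<beta> \<in> Poly_Mapping.keys (\<phi> t i)" for t \<beta>
  proof -
    obtain a b lam where t_eq: "t = (a, b, lam)" by (cases t)
    note vars = decompositionD(1)[OF dec t[unfolded t_eq], folded t_eq]
    have "mdeg \<beta> \<le> 2 * half_degree g"
    proof (cases "\<beta> = 0")
      case False
      then show ?thesis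
        using keys_separable[OF disj vars \<beta> False] decompositionD(2)[OF dec t[unfolded t_eq]]
        by (intro mdeg_lagrangian[of \<beta> g a b lam]) (simp add: t_eq)
    qed simp
    then have "(\<Sum>j\<in>UNIV. real (\<beta> $ j)) \<le> real (2 * half_degree g)"
      unfolding mdeg_def of_nat_sum[symmetric] of_nat_le_iff .
    then show ?thesis using vars[of i] \<beta>
      by (auto simp: B_def real_exponent_def only_variables_def simp flip: sum_divide_distrib)
  qed
  moreover have "0 \<in> B" by (simp add: B_def)
  ultimately have "convex hull ((\<lambda>v. (1/2) *\<^sub>R v) ` ({0} \<union>
      (\<Union>t\<in>supporting_triples g. real_exponent ` Poly_Mapping.keys (\<phi> t i)))) \<subseteq> B"
    by (intro hull_minimal) auto
  then have "real_exponent \<alpha> \<in> B" using \<alpha> by (auto simp: half_exponents_def)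
  then have "(\<Sum>j\<in>UNIV. real (\<alpha> $ j)) \<le> real (half_degree g)" "\<forall>j. j \<notin> I i \<longrightarrow> real (\<alpha> $ j) = 0"
    by (auto simp: B_def real_exponent_def)
  then show "mdeg \<alpha> \<le> half_degree g" "\<alpha> $ j \<noteq> 0 \<Longrightarrow> j \<in> I i"
    unfolding mdeg_def of_nat_sum[symmetric] of_nat_le_iff by auto
qed

section \<open>Exactness of the lift\<close>

context
  fixes g :: "'m::finite \<Rightarrow> 'n::finite mpoly" and I :: "'k::finite \<Rightarrow> 'n set"
    and \<phi> :: "(real^'n) \<times> real \<times> (real^'m) \<Rightarrow> 'k \<Rightarrow> 'n mpoly"
  assumes dec: "decomposition g I \<phi>" and disj: "disjoint_family I"
begin

lemma finite_half_exponents: "finite (half_exponents g \<phi> i)"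
  using half_exponents_bounds(1)[OF dec disj]
  by (intro finite_subset[OF _ finite_mdeg_le[of "half_degree g"]]) auto

lemma moment_matrix_eq:
  assumes "\<beta> \<in> half_exponents g \<phi> i" "\<gamma> \<in> half_exponents g \<phi> i"
  shows "moment_matrix d (I i) x y \<beta> \<gamma> = linearize d UNIV (Mon \<beta> * Mon \<gamma>) x y"
  unfolding moment_matrix_def
  by (rule linearize_only_variables)
     (use assms half_exponents_bounds(2)[OF dec disj] in \<open>auto simp: only_variables_def mult_single\<close>)

lemma psd_moment_matrix_iff:
  "psd_on (half_exponents g \<phi> i) (moment_matrix d (I i) x y)
    \<longleftrightarrow> psd_on (half_exponents g \<phi> i) (\<lambda>\<beta> \<gamma>. linearize d UNIV (Mon \<beta> * Mon \<gamma>) x y)"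
  by (simp add: psd_on_def symmetric_on_def moment_matrix_eq cong: sum.cong)

lemma feasible_set_subset_lift: "feasible_set g \<subseteq> sparse_lift g I \<phi>"
proof
  fix x assume x: "x \<in> feasible_set g"
  let ?d = "half_degree g"
  have "psd_on (half_exponents g \<phi> i) (\<lambda>\<beta> \<gamma>. linearize ?d UNIV (Mon \<beta> * Mon \<gamma>) x (eval_mon x))" for i
  proof -
    have eq: "linearize ?d UNIV (Mon \<beta> * Mon \<gamma>) x (eval_mon x) = eval_mon x \<beta> * eval_mon x \<gamma>"
      if "\<beta> \<in> half_exponents g \<phi> i" "\<gamma> \<in> half_exponents g \<phi> i" for \<beta> \<gamma>
    proof -
      have "mdeg (\<beta> + \<gamma>) \<le> 2 * ?d"
        using half_exponents_bounds(1)[OF dec disj] that by (force simp: mult_2 intro: add_mono)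
      then have "linearize ?d UNIV (Mon \<beta> * Mon \<gamma>) x (eval_mon x) = eval_mpoly (Mon \<beta> * Mon \<gamma>) x"
        by (intro linearize_moments) (auto simp: mult_single)
      then show ?thesis by (simp add: eval_Mon)
    qed
    have "0 \<le> (\<Sum>\<beta>\<in>half_exponents g \<phi> i. \<Sum>\<gamma>\<in>half_exponents g \<phi> i.
        v \<beta> * (eval_mon x \<beta> * eval_mon x \<gamma>) * v \<gamma>)" for v
    proof -
      have "(\<Sum>\<beta>\<in>half_exponents g \<phi> i. \<Sum>\<gamma>\<in>half_exponents g \<phi> i. v \<beta> * (eval_mon x \<beta> * eval_mon x \<gamma>) * v \<gamma>)
        = (\<Sum>\<beta>\<in>half_exponents g \<phi> i. v \<beta> * eval_mon x \<beta>) * (\<Sum>\<beta>\<in>half_exponents g \<phi> i. v \<beta> * eval_mon x \<beta>)"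
        by (simp add: sum_product mult_ac)
      then show ?thesis by simp
    qed
    moreover have "linearize ?d UNIV (Mon \<beta> * Mon \<gamma>) x (eval_mon x)
        = linearize ?d UNIV (Mon \<gamma> * Mon \<beta>) x (eval_mon x)" for \<beta> \<gamma>
      by (simp only: mult.commute)
    ultimately show ?thesis
      unfolding psd_on_def symmetric_on_def using finite_half_exponents by (simp add: eq cong: sum.cong)
  qed
  moreover have "0 \<le> linearize ?d UNIV (g k) x (eval_mon x)" for k
    using x by (subst linearize_moments[OF half_degree(2)]) (auto simp: feasible_set_def)
  ultimately show "x \<in> sparse_lift g I \<phi>"
    by (auto simp: sparse_lift_def psd_moment_matrix_iff)
qed

text \<open>
  Every \<open>\<phi> i\<close> is sos-convex with vanishing gradient at \<open>u\<close>, hence minus its value at \<open>u\<close> it is a sum of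
  squares. The exponents of the squares lie in the half Newton polytope of \<open>0\<close> and the exponents of
  \<open>\<phi> i\<close>; the point \<open>0\<close> accounts for the subtracted constant. So the moment matrices bound the
  functional from below, and the subtracted constants add up to the value of the Lagrangian at \<open>u\<close>,
  which is zero.
\<close>

lemma linearize_lagrangian_nonneg:
  assumes conc: "\<forall>k. sos_concave (g k)" and t: "(a, b, lam) \<in> supporting_triples g"
    and u: "a \<bullet> u = b" "a = (\<Sum>k\<in>UNIV. lam $ k *\<^sub>R gradient (g k) u)" "\<forall>k. lam $ k * eval_mpoly (g k) u = 0"
    and psd: "\<forall>i. psd_on (half_exponents g \<phi> i) (moment_matrix d (I i) x y)"
  shows "0 \<le> linearize d UNIV (lagrangian g a b lam) x y"
proof -
  define F where "F = lagrangian g a b lam"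
  define \<psi> where "\<psi> = \<phi> (a, b, lam)"
  have vars: "only_variables (I i) (\<psi> i)" for i
    unfolding \<psi>_def by (rule decompositionD(1)[OF dec t])
  have F: "F = (\<Sum>i\<in>UNIV. \<psi> i)" unfolding F_def \<psi>_def by (rule decompositionD(2)[OF dec t])
  have "\<forall>k. 0 \<le> lam $ k" using t by (auto simp: supporting_triples_def)
  then have "sos_convex F" unfolding F_def using conc by (intro sos_convex_lagrangian)
  have F0: "eval_mpoly F u = 0" by (simp only: F_def eval_lagrangian u(1,3) sum.neutral_const diff_self diff_0_right)
  have F1: "eval_mpoly (partial_deriv j F) u = 0" for j
    using arg_cong[OF u(2), of "\<lambda>v. v $ j"] by (simp add: F_def partial_deriv_lagrangian gradient_def)
  define \<sigma> where "\<sigma> i = \<psi> i - Const (eval_mpoly (\<psi> i) u)" for i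
  have "0 \<le> linearize d UNIV (\<sigma> i) x y" for i
  proof -
    have d\<sigma>: "partial_deriv j (\<sigma> i) = partial_deriv j (\<psi> i)" for j by (simp add: \<sigma>_def)
    have "sum_of_squares (\<sigma> i)"
    proof (rule sos_convex_sum_of_squares)
      show "sos_convex (\<sigma> i)"
        using sos_convex_separable[OF disj vars] \<open>sos_convex F\<close>
        by (simp add: sos_convex_def d\<sigma> F)
      show "eval_mpoly (\<sigma> i) u = 0" by (simp add: \<sigma>_def)
      show "eval_mpoly (partial_deriv j (\<sigma> i)) u = 0" for j
        unfolding d\<sigma> partial_deriv_separable[OF disj vars] F[symmetric] by (simp add: F1)
    qed
    then obtain qs where qs: "\<sigma> i = (\<Sum>q\<leftarrow>qs. q * q)" by (auto simp: sum_of_squares_def)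
    have "Poly_Mapping.keys (\<sigma> i) \<subseteq> insert 0 (Poly_Mapping.keys (\<psi> i))"
      by (auto simp: \<sigma>_def in_keys_iff lookup_minus lookup_single when_def split: if_splits)
    moreover have "real_exponent 0 = 0" by (simp add: real_exponent_def vec_eq_iff)
    ultimately have sub: "real_exponent ` Poly_Mapping.keys (\<sigma> i) \<subseteq>
        {0} \<union> (\<Union>t\<in>supporting_triples g. real_exponent ` Poly_Mapping.keys (\<phi> t i))"
      using t by (fastforce simp: \<psi>_def)
    have keys: "Poly_Mapping.keys q \<subseteq> half_exponents g \<phi> i" if "q \<in> set qs" for q
    proof
      fix \<beta> assume "\<beta> \<in> Poly_Mapping.keys q"
      from newton_polytope_sum_of_squares[OF that this] show "\<beta> \<in> half_exponents g \<phi> i"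
        unfolding qs[symmetric] half_exponents_def mem_Collect_eq
        by (rule subsetD[OF hull_mono[OF image_mono[OF sub]]])
    qed
    have "0 \<le> linearize d UNIV (\<Sum>q\<leftarrow>us. q * q) x y" if "set us \<subseteq> set qs" for us
      using that
    proof (induction us)
      case (Cons q us)
      then show ?case using linearize_square_nonneg[OF _ keys[of q]] psd
        by (simp add: linearize_add psd_moment_matrix_iff)
    qed simp
    then show ?thesis by (simp add: qs)
  qed
  then have "0 \<le> linearize d UNIV (\<Sum>i\<in>UNIV. \<sigma> i) x y"
    by (simp add: linearize_sum sum_nonneg)
  also have "(\<Sum>i\<in>UNIV. \<sigma> i) = F"
  proof -
    have "(\<Sum>i\<in>UNIV. Const (c i)) = Const (\<Sum>i\<in>UNIV. c i)" for c :: "'k \<Rightarrow> real"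
      by (rule poly_mapping_eqI) (simp add: lookup_sum lookup_single when_def)
    then have "(\<Sum>i\<in>UNIV. \<sigma> i) = F - Const (\<Sum>i\<in>UNIV. eval_mpoly (\<psi> i) u)"
      by (simp add: \<sigma>_def sum_subtractf F)
    moreover have "(\<Sum>i\<in>UNIV. eval_mpoly (\<psi> i) u) = 0" using F0 by (simp add: F)
    ultimately show ?thesis by simp
  qed
  finally show ?thesis by (simp add: F_def)
qed

text \<open>
  If \<open>x\<close> were outside the feasible set, the point \<open>u\<close> of the set closest to \<open>x\<close> together with \<open>a = u - x\<close>
  would yield a supporting triple. Linearizing its Lagrangian at \<open>x\<close> gives a nonnegative number by
  \<open>linearize_lagrangian_nonneg\<close>, but also at most \<open>a\<^sup>T x - a\<^sup>T u = -\<bar>a\<bar>\<^sup>2\<close>.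
\<close>

lemma lift_subset_feasible_set:
  assumes conc: "\<forall>k. sos_concave (g k)" and int: "interior (feasible_set g) \<noteq> {}"
  shows "sparse_lift g I \<phi> \<subseteq> feasible_set g"
proof (rule subsetI, rule ccontr)
  fix x assume "x \<in> sparse_lift g I \<phi>" and x: "x \<notin> feasible_set g"
  let ?S = "feasible_set g" and ?L = "linearize (half_degree g) UNIV"
  obtain y where y: "\<forall>k. 0 \<le> ?L (g k) x y"
    and psd: "\<forall>i. psd_on (half_exponents g \<phi> i) (moment_matrix (half_degree g) (I i) x y)"
    using \<open>x \<in> sparse_lift g I \<phi>\<close> by (auto simp: sparse_lift_def)
  obtain p where p: "p \<in> interior ?S" using int by blast
  then have ne: "?S \<noteq> {}" using interior_subset by blast
  define u where "u = closest_point ?S x"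
  define a where "a = u - x"
  have u: "u \<in> ?S" unfolding u_def by (rule closest_point_in_set[OF closed_feasible_set ne])
  then have "a \<noteq> 0" using x by (auto simp: a_def)
  have min: "a \<bullet> u \<le> a \<bullet> z" if "z \<in> ?S" for z
    using closest_point_dot[OF convex_feasible_set[OF conc] closed_feasible_set that, of x]
    by (simp add: a_def u_def inner_diff_left inner_diff_right)
  have "u \<notin> interior ?S"
  proof
    assume "u \<in> interior ?S"
    then obtain e where e: "0 < e" "ball u e \<subseteq> ?S" by (auto simp: mem_interior)
    define z where "z = u - (e / (2 * norm a)) *\<^sub>R a"
    have "dist u z < e" using e \<open>a \<noteq> 0\<close> by (simp add: z_def dist_norm)
    then have "a \<bullet> u \<le> a \<bullet> z" using e by (intro min) auto
    moreover have "0 < e / (2 * norm a) * (a \<bullet> a)" using e \<open>a \<noteq> 0\<close> by simp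
    ultimately show False by (simp add: z_def inner_diff_right)
  qed
  then have fr: "u \<in> frontier ?S"
    using u closed_feasible_set[of g] by (simp add: frontier_def closure_closed)
  obtain lam where lam: "\<forall>k. 0 \<le> lam $ k" "\<forall>k. lam $ k * eval_mpoly (g k) u = 0"
    "a = (\<Sum>k\<in>UNIV. lam $ k *\<^sub>R gradient (g k) u)"
    using lagrange_multipliers[OF conc p u min] by blast
  have "(a, a \<bullet> u, lam) \<in> supporting_triples g"
    using \<open>a \<noteq> 0\<close> lam min fr by (auto simp: supporting_triples_def)
  from linearize_lagrangian_nonneg[OF conc this refl lam(3,2) psd]
  have "0 \<le> ?L (lagrangian g a (a \<bullet> u) lam) x y" .
  also have "\<dots> = a \<bullet> x - a \<bullet> u - (\<Sum>k\<in>UNIV. lam $ k * ?L (g k) x y)"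
    by (simp add: lagrangian_def linearize_diff linearize_sum linearize_Const_mult inner_vec_def
        del: single_mult_Const)
  also have "\<dots> \<le> a \<bullet> x - a \<bullet> u"
    using lam(1) y by (simp add: sum_nonneg)
  also have "\<dots> = - (a \<bullet> a)" by (simp add: a_def inner_diff_right)
  finally have "a \<bullet> a \<le> 0" by simp
  then show False using \<open>a \<noteq> 0\<close> inner_gt_zero_iff[of a] by linarith
qed

end

section \<open>The lift as a single linear matrix inequality\<close>

lemma psd_on_bij_betw:
  assumes e: "bij_betw e A B"
  shows "psd_on A (\<lambda>p q. X (e p) (e q)) \<longleftrightarrow> psd_on B X"
proof -
  have B: "B = e ` A" and inj: "inj_on e A" using e by (auto simp: bij_betw_def)
  have s: "(\<Sum>p\<in>B. \<Sum>q\<in>B. v p * X p q * v q) = (\<Sum>p\<in>A. \<Sum>q\<in>A. v (e p) * X (e p) (e q) * v (e q))" for v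
    unfolding B by (simp add: sum.reindex[OF inj] o_def)
  have "(\<forall>v. 0 \<le> (\<Sum>p\<in>A. \<Sum>q\<in>A. v p * X (e p) (e q) * v q)) \<longleftrightarrow>
      (\<forall>v. 0 \<le> (\<Sum>p\<in>B. \<Sum>q\<in>B. v p * X p q * v q))" (is "?l \<longleftrightarrow> ?r")
  proof
    assume l: ?l
    show ?r unfolding s
    proof
      fix v
      show "0 \<le> (\<Sum>p\<in>A. \<Sum>q\<in>A. v (e p) * X (e p) (e q) * v (e q))"
        using l[rule_format, of "\<lambda>p. v (e p)"] .
    qed
  next
    assume r: ?r
    show ?l
    proof
      fix v :: "_ \<Rightarrow> real"
      have "(\<Sum>p\<in>A. \<Sum>q\<in>A. v p * X (e p) (e q) * v q) = (\<Sum>p\<in>A. \<Sum>q\<in>A.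
          v (inv_into A e (e p)) * X (e p) (e q) * v (inv_into A e (e q)))"
        using inj by (intro sum.cong refl) simp
      then show "0 \<le> (\<Sum>p\<in>A. \<Sum>q\<in>A. v p * X (e p) (e q) * v q)"
        using r[rule_format, of "\<lambda>b. v (inv_into A e b)"] unfolding s by simp
    qed
  qed
  then show ?thesis using inj by (auto simp: psd_on_def symmetric_on_def B finite_image_iff)
qed

text \<open>
  Arbitrary finite index sets for the rows and for the lifting variables may be renumbered by
  initial segments of the natural numbers.
\<close>

lemma sdp_representableI:
  fixes T :: "(real^'n::finite) set" and D :: "'i set" and Y :: "'j set"
  assumes fin: "finite D" "finite Y"
    and sym: "symmetric_on D A" "\<And>i. symmetric_on D (B i)" "\<And>j. j \<in> Y \<Longrightarrow> symmetric_on D (C j)"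
    and T: "T = {x. \<exists>y :: 'j \<Rightarrow> real. psd_on D
       (\<lambda>p q. A p q + (\<Sum>i\<in>UNIV. x $ i * B i p q) + (\<Sum>j\<in>Y. y j * C j p q))}"
  shows "sdp_representable T"
proof -
  obtain e :: "nat \<Rightarrow> 'i" where e: "bij_betw e {..<card D} D"
    using ex_bij_betw_nat_finite[OF fin(1)] by (auto simp: atLeast0LessThan)
  obtain f :: "nat \<Rightarrow> 'j" where f: "bij_betw f {..<card Y} Y"
    using ex_bij_betw_nat_finite[OF fin(2)] by (auto simp: atLeast0LessThan)
  have eD: "e p \<in> D" if "p < card D" for p using e that by (auto simp: bij_betw_def)
  have fY: "f j \<in> Y" if "j < card Y" for j using f that by (auto simp: bij_betw_def)
  have re: "(\<Sum>j\<in>Y. h j) = (\<Sum>j<card Y. h (f j))" for h :: "'j \<Rightarrow> real"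
    by (rule sum.reindex_bij_betw[OF f, symmetric])
  let ?M = "\<lambda>x w p q. A (e p) (e q) + (\<Sum>i\<in>UNIV. x $ i * B i (e p) (e q))
      + (\<Sum>j<card Y. w j * C (f j) (e p) (e q))"
  have "(\<exists>y. psd_on D (\<lambda>p q. A p q + (\<Sum>i\<in>UNIV. x $ i * B i p q) + (\<Sum>j\<in>Y. y j * C j p q)))
      \<longleftrightarrow> (\<exists>w. psd_on {..<card D} (?M x w))" for x
  proof
    assume "\<exists>y. psd_on D (\<lambda>p q. A p q + (\<Sum>i\<in>UNIV. x $ i * B i p q) + (\<Sum>j\<in>Y. y j * C j p q))"
    then obtain y where "psd_on D (\<lambda>p q. A p q + (\<Sum>i\<in>UNIV. x $ i * B i p q) + (\<Sum>j\<in>Y. y j * C j p q))" ..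
    then have "psd_on {..<card D} (?M x (y \<circ> f))"
      unfolding psd_on_bij_betw[OF e, symmetric] by (simp add: re)
    then show "\<exists>w. psd_on {..<card D} (?M x w)" by (rule exI[of _ "y \<circ> f"])
  next
    assume "\<exists>w. psd_on {..<card D} (?M x w)"
    then obtain w where w: "psd_on {..<card D} (?M x w)" ..
    have "w j = ((w \<circ> inv_into {..<card Y} f) \<circ> f) j" if "j \<in> {..<card Y}" for j
      using f that by (simp add: bij_betw_def)
    then have "(\<Sum>j<card Y. w j * h j) = (\<Sum>j<card Y. ((w \<circ> inv_into {..<card Y} f) \<circ> f) j * h j)"
      for h :: "nat \<Rightarrow> real" by (intro sum.cong refl) simp
    then have "psd_on {..<card D} (?M x ((w \<circ> inv_into {..<card Y} f) \<circ> f))"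
      using w by (simp only:)
    then have "psd_on D (\<lambda>p q. A p q + (\<Sum>i\<in>UNIV. x $ i * B i p q)
        + (\<Sum>j\<in>Y. (w \<circ> inv_into {..<card Y} f) j * C j p q))"
      unfolding psd_on_bij_betw[OF e, symmetric] by (simp add: re)
    then show "\<exists>y. psd_on D (\<lambda>p q. A p q + (\<Sum>i\<in>UNIV. x $ i * B i p q) + (\<Sum>j\<in>Y. y j * C j p q))" by blast
  qed
  then have "T = {x. \<exists>w. psd_on {..<card D} (?M x w)}" by (simp add: T)
  moreover have "symmetric_on {..<card D} (\<lambda>p q. A (e p) (e q))"
    "\<forall>i. symmetric_on {..<card D} (\<lambda>p q. B i (e p) (e q))"
    "\<forall>j<card Y. symmetric_on {..<card D} (\<lambda>p q. C (f j) (e p) (e q))"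
    using sym eD fY by (auto simp: symmetric_on_def)
  ultimately show ?thesis unfolding sdp_representable_def
    by (intro exI[of _ "card D"] exI[of _ "card Y"] exI[of _ "\<lambda>p q. A (e p) (e q)"]
        exI[of _ "\<lambda>i p q. B i (e p) (e q)"] exI[of _ "\<lambda>j p q. C (f j) (e p) (e q)"] conjI)
qed

lemma psd_on_block_diagonal:
  fixes K :: "'a set" and F :: "'a \<Rightarrow> 'b set" and X :: "'a \<Rightarrow> 'b \<Rightarrow> 'b \<Rightarrow> real"
  assumes K: "finite K" and F: "\<And>i. i \<in> K \<Longrightarrow> finite (F i)"
  shows "psd_on (Sigma K F) (\<lambda>(i, p) (j, q). if i = j then X i p q else 0)
    \<longleftrightarrow> (\<forall>i\<in>K. psd_on (F i) (X i))"
proof -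
  have split: "(\<Sum>z\<in>Sigma K F. h z) = (\<Sum>i\<in>K. \<Sum>p\<in>F i. h (i, p))" for h :: "'a \<times> 'b \<Rightarrow> real"
    using K F by (subst sum.Sigma) auto
  have s: "(\<Sum>z\<in>Sigma K F. \<Sum>z'\<in>Sigma K F. v z * (case z of (i, p) \<Rightarrow> \<lambda>(j, q). if i = j then X i p q else 0) z' * v z')
     = (\<Sum>i\<in>K. \<Sum>p\<in>F i. \<Sum>q\<in>F i. v (i, p) * X i p q * v (i, q))" for v :: "'a \<times> 'b \<Rightarrow> real"
  proof -
    have "(\<Sum>z'\<in>Sigma K F. v (i, p) * (case z' of (j, q) \<Rightarrow> if i = j then X i p q else 0) * v z')
      = (\<Sum>q\<in>F i. v (i, p) * X i p q * v (i, q))" if "i \<in> K" for i p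
    proof -
      have "(\<Sum>z'\<in>Sigma K F. v (i, p) * (case z' of (j, q) \<Rightarrow> if i = j then X i p q else 0) * v z')
        = (\<Sum>j\<in>K. \<Sum>q\<in>F j. v (i, p) * (if i = j then X i p q else 0) * v (j, q))"
        by (subst split) simp
      also have "\<dots> = (\<Sum>j\<in>K. if j = i then \<Sum>q\<in>F i. v (i, p) * X i p q * v (i, q) else 0)"
        by (intro sum.cong refl) (auto intro!: sum.neutral)
      finally show ?thesis using that K by simp
    qed
    then show ?thesis by (subst split) (auto intro!: sum.cong)
  qed
  show ?thesis
  proof
    assume psd: "psd_on (Sigma K F) (\<lambda>(i, p) (j, q). if i = j then X i p q else 0)"
    show "\<forall>i\<in>K. psd_on (F i) (X i)"
    proof
      fix i assume i: "i \<in> K"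
      have "symmetric_on (F i) (X i)" unfolding symmetric_on_def
      proof (intro ballI)
        fix p q assume "p \<in> F i" "q \<in> F i"
        then have "(i, p) \<in> Sigma K F" "(i, q) \<in> Sigma K F" using i by auto
        then show "X i p q = X i q p" using psd by (fastforce simp: psd_on_def symmetric_on_def)
      qed
      moreover have "0 \<le> (\<Sum>p\<in>F i. \<Sum>q\<in>F i. v p * X i p q * v q)" for v
      proof -
        have "0 \<le> (\<Sum>j\<in>K. \<Sum>p\<in>F j. \<Sum>q\<in>F j. (if j = i then v p else 0) * X j p q * (if j = i then v q else 0))"
          using psd[unfolded psd_on_def s, THEN conjunct2, THEN conjunct2, THEN spec,
              of "\<lambda>(j, p). if j = i then v p else 0"] by simp
        also have "\<dots> = (\<Sum>j\<in>K. if j = i then \<Sum>p\<in>F i. \<Sum>q\<in>F i. v p * X i p q * v q else 0)"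
          by (intro sum.cong refl) (auto intro!: sum.neutral)
        finally show ?thesis using K i by simp
      qed
      ultimately show "psd_on (F i) (X i)" using F i by (simp add: psd_on_def)
    qed
  next
    assume psd: "\<forall>i\<in>K. psd_on (F i) (X i)"
    have "symmetric_on (Sigma K F) (\<lambda>(i, p) (j, q). if i = j then X i p q else 0)"
      using psd by (auto simp: symmetric_on_def psd_on_def)
    moreover have "0 \<le> (\<Sum>i\<in>K. \<Sum>p\<in>F i. \<Sum>q\<in>F i. v (i, p) * X i p q * v (i, q))" for v
    proof (rule sum_nonneg)
      fix i assume "i \<in> K"
      then have "\<forall>v. 0 \<le> (\<Sum>p\<in>F i. \<Sum>q\<in>F i. v p * X i p q * v q)"
        using psd unfolding psd_on_def by blast
      then show "0 \<le> (\<Sum>p\<in>F i. \<Sum>q\<in>F i. v (i, p) * X i p q * v (i, q))"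
        by (rule spec[of _ "\<lambda>p. v (i, p)"])
    qed
    ultimately show "psd_on (Sigma K F) (\<lambda>(i, p) (j, q). if i = j then X i p q else 0)"
      using K F by (simp add: psd_on_def s)
  qed
qed

lemma psd_on_singleton: "psd_on {a} X \<longleftrightarrow> 0 \<le> X a a"
proof -
  have "(\<forall>v :: 'a \<Rightarrow> real. 0 \<le> v a * X a a * v a) \<longleftrightarrow> 0 \<le> X a a"
  proof
    assume "\<forall>v :: 'a \<Rightarrow> real. 0 \<le> v a * X a a * v a"
    from this[rule_format, of "\<lambda>_. 1"] show "0 \<le> X a a" by simp
  next
    assume "0 \<le> X a a"
    then have "0 \<le> X a a * (v a * v a)" for v :: "'a \<Rightarrow> real" by simp
    then show "\<forall>v :: 'a \<Rightarrow> real. 0 \<le> v a * X a a * v a" by (simp add: mult_ac)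
  qed
  then show ?thesis by (simp add: psd_on_def symmetric_on_def)
qed

text \<open>
  The scalar constraints are blocks of size one and the moment matrices are the other blocks of
  one matrix. All its entries are linearizations of polynomials, hence affine in \<open>x\<close> and \<open>y\<close>.
\<close>

lemma sdp_representable_sparse_lift:
  fixes g :: "'m::finite \<Rightarrow> 'n::finite mpoly" and I :: "'k::finite \<Rightarrow> 'n set"
  assumes dec: "decomposition g I \<phi>" and disj: "disjoint_family I"
  shows "sdp_representable (sparse_lift g I \<phi>)"
proof -
  let ?d = "half_degree g"
  \<comment> \<open>The index set \<open>{0}\<close> of a scalar constraint is an arbitrary singleton.\<close>
  define F :: "'m + 'k \<Rightarrow> (nat^'n) set" where
    "F = case_sum (\<lambda>k. {0}) (half_exponents g \<phi>)"
  define E :: "'m + 'k \<Rightarrow> nat^'n \<Rightarrow> nat^'n \<Rightarrow> 'n mpoly" where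
    "E = case_sum (\<lambda>k \<beta> \<gamma>. g k) (\<lambda>i \<beta> \<gamma>. Mon \<beta> * Mon \<gamma>)"
  define Q where "Q = (\<lambda>(l, \<beta>) (l', \<gamma>). if l = l' then E l \<beta> \<gamma> else 0)"
  define D where "D = Sigma UNIV F"
  define Y where "Y = {\<alpha> :: nat^'n. 1 < mdeg \<alpha> \<and> mdeg \<alpha> \<le> 2 * ?d}"
  have finF: "finite (F l)" for l
    using finite_half_exponents[OF dec disj] by (cases l) (auto simp: F_def)
  have blocks: "psd_on D (\<lambda>z z'. linearize ?d UNIV (Q z z') x y) \<longleftrightarrow>
      (\<forall>k. 0 \<le> linearize ?d UNIV (g k) x y) \<and>
      (\<forall>i. psd_on (half_exponents g \<phi> i) (moment_matrix ?d (I i) x y))" for x y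
  proof -
    have "(\<lambda>z z'. linearize ?d UNIV (Q z z') x y)
      = (\<lambda>(l, \<beta>) (l', \<gamma>). if l = l' then linearize ?d UNIV (E l \<beta> \<gamma>) x y else 0)"
      by (auto simp: Q_def fun_eq_iff)
    then have "psd_on D (\<lambda>z z'. linearize ?d UNIV (Q z z') x y) \<longleftrightarrow>
        (\<forall>l. psd_on (F l) (\<lambda>\<beta> \<gamma>. linearize ?d UNIV (E l \<beta> \<gamma>) x y))"
      unfolding D_def using psd_on_block_diagonal[of UNIV F "\<lambda>l \<beta> \<gamma>. linearize ?d UNIV (E l \<beta> \<gamma>) x y"] finF
      by simp
    also have "\<dots> \<longleftrightarrow> (\<forall>k. 0 \<le> linearize ?d UNIV (g k) x y) \<and>
      (\<forall>i. psd_on (half_exponents g \<phi> i) (\<lambda>\<beta> \<gamma>. linearize ?d UNIV (Mon \<beta> * Mon \<gamma>) x y))"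
      by (simp add: split_sum_all F_def E_def psd_on_singleton)
    finally show ?thesis by (simp add: psd_moment_matrix_iff[OF dec disj])
  qed
  show ?thesis
  proof (rule sdp_representableI)
    show "finite D" unfolding D_def using finF by (intro finite_SigmaI) auto
    show "finite Y" unfolding Y_def
      by (rule finite_subset[OF _ finite_mdeg_le[of "2 * ?d"]]) auto
    have Q: "Q z z' = Q z' z" for z z'
      by (cases z; cases z'; cases "fst z")
         (auto simp: Q_def E_def mult.commute)
    have sym: "symmetric_on D (\<lambda>z z'. Poly_Mapping.lookup (Q z z') \<alpha>)" for \<alpha>
      unfolding symmetric_on_def by (metis Q)
    show "symmetric_on D (\<lambda>z z'. Poly_Mapping.lookup (Q z z') 0)" by (rule sym)
    show "symmetric_on D (\<lambda>z z'. Poly_Mapping.lookup (Q z z') (axis i 1))" for i by (rule sym)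
    show "symmetric_on D (\<lambda>z z'. Poly_Mapping.lookup (Q z z') \<alpha>)" for \<alpha> by (rule sym)
    have "sparse_lift g I \<phi> = {x. \<exists>y. psd_on D (\<lambda>z z'. linearize ?d UNIV (Q z z') x y)}"
      by (simp only: sparse_lift_def blocks)
    then show "sparse_lift g I \<phi> = {x. \<exists>y. psd_on D (\<lambda>z z'. Poly_Mapping.lookup (Q z z') 0
        + (\<Sum>i\<in>UNIV. x $ i * Poly_Mapping.lookup (Q z z') (axis i 1))
        + (\<Sum>\<alpha>\<in>Y. y \<alpha> * Poly_Mapping.lookup (Q z z') \<alpha>))}"
      unfolding linearize_def Y_def .
  qed
qed

theorem theorem3p2:
  fixes g :: "'m::finite \<Rightarrow> 'n::finite mpoly"
    and I :: "'k::finite \<Rightarrow> 'n set"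
    and \<phi> :: "(real^'n) \<times> real \<times> (real^'m) \<Rightarrow> 'k \<Rightarrow> 'n mpoly"
  assumes "\<forall>k. sos_concave (g k)"
    and "interior (feasible_set g) \<noteq> {}"
    and "disjoint_family I" and "(\<Union>i. I i) = UNIV"
    and "decomposition g I \<phi>"
  shows "feasible_set g = sparse_lift g I \<phi>
    \<and> convex (feasible_set g) \<and> sdp_representable (sparse_lift g I \<phi>)"
  using feasible_set_subset_lift[OF assms(5,3)] lift_subset_feasible_set[OF assms(5,3,1,2)]
    convex_feasible_set[OF assms(1)] sdp_representable_sparse_lift[OF assms(5,3)]
  by (intro conjI equalityI)

end
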